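(* Suppose that $\mu,\nu$ are Radon probability measures on $\sigma(\tau(\mathcal{G}))$ such that $$\int_{\Omega}p\,d\mu<\infty,\qquad \int_{\Omega}p\,d\nu<\infty,$$ and that $$\int_{\Omega}f\,d\mu\leq\int_{\Omega}f\,d\nu\quad\text{for all }f\in\mathcal{F}.\tag{1}$$ Then there exists a Radon measure $\pi$ on $\Omega\times\Omega$ with marginals $\mu$ and $\nu$ such that for all $f\in\mathcal{F}$ and all non-negative, bounded, $\sigma(\tau(\mathcal{G}))$-measurable functions $h$ on $\Omega$ $$\int_{\Omega}h(\omega_1)f(\omega_1)\,d\mu(\omega_1)\leq\int_{\Omega\times\Omega}h(\omega_1)f(\omega_2)\,d\pi(\omega_1,\omega_2).\tag{2}$$ Conversely, if a Radon measure $\pi$ on $\Omega\times\Omega$ with marginals $\mu$ and $\nu$ satisfies (2) for all such $f$ and $h$, then $\mu$ and $\nu$ satisfy (1).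
   Context: $\Omega$ is a set and $\mathcal{G}$ is a convex cone of real-valued functions on $\Omega$ (closed under linear combinations with non-negative coefficients) that contains the constant functions and separates points of $\Omega$. $\tau(\mathcal{G})$ is the coarsest topology on $\Omega$ making all elements of $\mathcal{G}$ continuous, and $\sigma(\tau(\mathcal{G}))$ is its Borel $\sigma$-algebra; topological notions on $\Omega$ refer to $\tau(\mathcal{G})$, and $\Omega\times\Omega$ has the product topology. No metrisability, separability or local compactness of $\Omega$ is assumed. $\mathcal{F}$ is the lattice cone generated by $\mathcal{G}$: the smallest convex cone of functions on $\Omega$ containing $\mathcal{G}$ and stable under maxima of two functions (equivalently, the set of maxima of finite non-empty families in $\mathcal{G}$). $\mathcal{H}$ is the complete lattice cone generated by $\mathcal{G}$: the smallest convex cone of $(-\infty,\infty]$-valued functions containing $\mathcal{G}$ and stable under arbitrary suprema. $p\colon\Omega\to[0,\infty)$ is a fixed function in $\mathcal{H}$ that is proper with respect to $\tau(\mathcal{G})$ (preimages of compact subsets of $\mathbb{R}$ are compact), and each $g\in\mathcal{G}$ is of $(p+1)$-growth: there is $C>0$ with $|g|\leq C(p+1)$ on $\Omega$. A measure $m$ on Borel sets is Radon if for every Borel set $B$ and every $\epsilon>0$ there is a compact $K\subset B$ with $|m|(B\setminus K)<\epsilon$. The marginals of a measure on $\Omega\times\Omega$ are its push-forwards under the two coordinate projections. *)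

theory Defs
  imports "HOL-Probability.Probability"
begin

(* The set Omega is the universe of the type 'a.  As the topology tau(G) depends on the cone G,
   it is a value of type "'a topology" rather than a type class instance. *)

definition convex_cone_of_functions :: "('a \<Rightarrow> real) set \<Rightarrow> bool" where
  "convex_cone_of_functions C \<longleftrightarrow>
     C \<noteq> {} \<and> (\<forall>f\<in>C. \<forall>g\<in>C. \<forall>a\<ge>0. \<forall>b\<ge>0. (\<lambda>x. a * f x + b * g x) \<in> C)"

(* Functions with values in (-oo, oo]; in ereal, 0 * oo = 0. *)
definition convex_cone_of_ereal_functions :: "('a \<Rightarrow> ereal) set \<Rightarrow> bool" where
  "convex_cone_of_ereal_functions C \<longleftrightarrow>
     C \<noteq> {} \<and> (\<forall>f\<in>C. \<forall>x. f x \<noteq> -\<infinity>) \<and>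
     (\<forall>f\<in>C. \<forall>g\<in>C. \<forall>a\<ge>0. \<forall>b\<ge>0. (\<lambda>x. ereal a * f x + ereal b * g x) \<in> C)"

definition separates_points :: "('a \<Rightarrow> real) set \<Rightarrow> bool" where
  "separates_points G \<longleftrightarrow> (\<forall>x y. x \<noteq> y \<longrightarrow> (\<exists>g\<in>G. g x \<noteq> g y))"

definition lattice_cone :: "('a \<Rightarrow> real) set \<Rightarrow> ('a \<Rightarrow> real) set" where
  "lattice_cone G = \<Inter>{C. convex_cone_of_functions C \<and> G \<subseteq> C \<and>
     (\<forall>f\<in>C. \<forall>g\<in>C. (\<lambda>x. max (f x) (g x)) \<in> C)}"

(* Suprema are over non-empty families: the empty one would give the constant -oo. *)
definition complete_lattice_cone :: "('a \<Rightarrow> real) set \<Rightarrow> ('a \<Rightarrow> ereal) set" where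
  "complete_lattice_cone G = \<Inter>{C. convex_cone_of_ereal_functions C \<and>
     (\<forall>g\<in>G. (\<lambda>x. ereal (g x)) \<in> C) \<and>
     (\<forall>S. S \<subseteq> C \<and> S \<noteq> {} \<longrightarrow> (\<lambda>x. SUP f\<in>S. f x) \<in> C)}"

definition initial_topology :: "('a \<Rightarrow> real) set \<Rightarrow> 'a topology" where
  "initial_topology G = topology_generated_by {g -` U | g U. g \<in> G \<and> open U}"

definition borel_of :: "'a topology \<Rightarrow> 'a measure" where
  "borel_of T = sigma (topspace T) {U. openin T U}"

definition proper_function :: "'a topology \<Rightarrow> ('a \<Rightarrow> real) \<Rightarrow> bool" where
  "proper_function T p \<longleftrightarrow> (\<forall>K. compact K \<longrightarrow> compactin T (p -` K \<inter> topspace T))"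

(* The condition K \<in> sets M is automatic for Hausdorff T; it is needed in general because emeasure
   is 0 outside sets M. *)
definition radon_measure :: "'a topology \<Rightarrow> 'a measure \<Rightarrow> bool" where
  "radon_measure T M \<longleftrightarrow> sets M = sets (borel_of T) \<and>
     (\<forall>B\<in>sets M. \<forall>\<epsilon>>0. \<exists>K. K \<subseteq> B \<and> compactin T K \<and> K \<in> sets M \<and>
        emeasure M (B - K) < ennreal \<epsilon>)"

(* The measures on the product live on the Borel sets of the product topology, which may be
   strictly more than the product of the Borel sigma-algebras. *)
definition has_marginals ::
    "'a topology \<Rightarrow> ('a \<times> 'a) measure \<Rightarrow> 'a measure \<Rightarrow> 'a measure \<Rightarrow> bool" where
  "has_marginals T \<pi> \<mu> \<nu> \<longleftrightarrow>
     distr \<pi> (borel_of T) fst = \<mu> \<and> distr \<pi> (borel_of T) snd = \<nu>"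

end

theory Submission
  imports Defs
begin

text \<open>Why the theorem holds.  The converse direction is the special case \<open>h = 1\<close>, combined with the
  fact that the second marginal of \<open>\<pi>\<close> is \<open>\<nu>\<close>.  The existence of \<open>\<pi>\<close> is a linear programming
  duality.  Let \<open>F\<close> be the lattice cone.  For a bounded function \<open>\<phi>\<close> of two variables consider the
  infimum of \<open>\<integral>u d\<mu> + \<integral>v d\<nu>\<close> over all \<open>u\<close> (lower semicontinuous) and \<open>v\<close> such that
  \<open>\<phi> (x, y) \<le> u x + v y + \<Phi> x x - \<Phi> x y\<close> for some family of functions \<open>\<Phi> x\<close> in \<open>F\<close>.  This is a
  sublinear functional of \<open>\<phi>\<close>, provided that it does not take the value \<open>- \<infinity>\<close>.

  Finiteness is where domination of \<open>\<mu>\<close> by \<open>\<nu>\<close> is used (\<open>majorised_zero\<close>).  If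
  \<open>0 \<le> u x + v y + \<Phi> x x - \<Phi> x y\<close>, then \<open>v\<close> dominates the supremum over \<open>x\<close> of the functions
  \<open>\<Phi> x - u x - \<Phi> x x\<close>, and this supremum dominates \<open>- u\<close>.  On compact sets a maximum of finitely many of
  these functions is good enough; it belongs to \<open>F\<close>, and its integrals with respect to \<open>\<mu>\<close> and \<open>\<nu>\<close>
  compare, so that \<open>- \<integral>u d\<mu> \<le> \<integral>v d\<nu>\<close>.

  By the Hahn--Banach theorem (\<open>linear_below_sublinear\<close>) a linear functional lies below the sublinear
  one.  Its values on indicators form a finitely additive set function which is bounded by \<open>\<mu>\<close> and
  \<open>\<nu>\<close> on suitable strips; it is therefore tight, and can be regularised to a Radon measure \<open>\<pi>\<close>
  on the product space (\<open>radon_regularisation\<close>).  Regularisation decreases open sets and increases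
  closed sets.  The former determines the marginals of \<open>\<pi>\<close> (\<open>radon_measure_eqI\<close>), and the latter
  preserves the desired inequality for \<open>h = indicator K\<close> with \<open>K\<close> compact and for non-negative \<open>f\<close>,
  because then \<open>h x * f y\<close> is upper semicontinuous (\<open>compact_inequality\<close>).  Inner regularity of \<open>\<mu>\<close>
  extends the inequality to all \<open>h\<close>, and truncation from below extends it to all \<open>f\<close>.

  The function \<open>p\<close> bounds the members of the cone up to constants, so all of them are integrable.\<close>

section \<open>Linear functionals below a sublinear one\<close>

text \<open>Homogeneity for positive factors forces the value \<open>0\<close> at the origin, since
  \<open>q 0 = 2 * q 0\<close>.\<close>
definition sublinear :: "('v::real_vector \<Rightarrow> real) \<Rightarrow> bool" where
  "sublinear q \<longleftrightarrow> (\<forall>x y. q (x + y) \<le> q x + q y) \<and> (\<forall>c>0. \<forall>x. q (c *\<^sub>R x) = c * q x)"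

lemma sublinearD:
  assumes "sublinear q"
  shows "q (x + y) \<le> q x + q y" and "0 \<le> c \<Longrightarrow> q (c *\<^sub>R x) = c * q x" and "- q (- x) \<le> q x"
proof -
  show add: "q (x + y) \<le> q x + q y" for x y
    using assms by (auto simp: sublinear_def)
  have "q (2 *\<^sub>R 0) = 2 * q 0"
    using assms unfolding sublinear_def by (metis zero_less_numeral)
  then have "q 0 = 0" by simp
  then show "0 \<le> c \<Longrightarrow> q (c *\<^sub>R x) = c * q x"
    using assms by (cases "c = 0") (auto simp: sublinear_def)
  show "- q (- x) \<le> q x"
    using add[of x "- x"] \<open>q 0 = 0\<close> by simp
qed

text \<open>For fixed \<open>a\<close>, the infimum over \<open>t \<ge> 0\<close> of \<open>m (x + t a) - t m(a)\<close> is again sublinear and lies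
  below \<open>m\<close>.  Minimality makes it equal to \<open>m\<close>, and \<open>t = 1\<close> then gives superadditivity.\<close>
lemma linear_if_minimal_sublinear:
  fixes m :: "'v::real_vector \<Rightarrow> real"
  assumes m: "sublinear m" and min: "\<And>q. sublinear q \<Longrightarrow> (\<And>x. q x \<le> m x) \<Longrightarrow> q = m"
  shows "linear m"
proof -
  have add_ge: "m x + m a \<le> m (x + a)" for x a
  proof -
    define n where "n y = (INF t\<in>{0::real..}. m (y + t *\<^sub>R a) - t * m a)" for y
    have bdd: "bdd_below ((\<lambda>t. m (y + t *\<^sub>R a) - t * m a) ` {0::real..})" for y
    proof (rule bdd_belowI2)
      fix t :: real assume "t \<in> {0..}"
      then have "t * m a = m ((y + t *\<^sub>R a) + (- y))"
        using sublinearD(2)[OF m] by simp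
      also have "\<dots> \<le> m (y + t *\<^sub>R a) + m (- y)"
        by (rule sublinearD(1)[OF m])
      finally show "- m (- y) \<le> m (y + t *\<^sub>R a) - t * m a" by simp
    qed
    have le: "n y \<le> m (y + t *\<^sub>R a) - t * m a" if "0 \<le> t" for y t
      unfolding n_def by (rule cINF_lower[OF bdd]) (use that in simp)
    have ge: "z \<le> n y" if "\<And>t. 0 \<le> t \<Longrightarrow> z \<le> m (y + t *\<^sub>R a) - t * m a" for y z
      unfolding n_def by (rule cINF_greatest) (use that in auto)
    have n_scale_le: "n (c *\<^sub>R y) \<le> c * n y" if "0 < c" for c y
    proof -
      have "n (c *\<^sub>R y) / c \<le> m (y + t *\<^sub>R a) - t * m a" if "0 \<le> t" for t
      proof -
        have "n (c *\<^sub>R y) \<le> m (c *\<^sub>R y + (c * t) *\<^sub>R a) - (c * t) * m a"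
          by (rule le) (use that \<open>0 < c\<close> in simp)
        also have "c *\<^sub>R y + (c * t) *\<^sub>R a = c *\<^sub>R (y + t *\<^sub>R a)"
          by (simp add: scaleR_add_right)
        also have "m \<dots> = c * m (y + t *\<^sub>R a)"
          using sublinearD(2)[OF m] \<open>0 < c\<close> by simp
        finally show ?thesis using \<open>0 < c\<close> by (simp add: field_simps)
      qed
      then have "n (c *\<^sub>R y) / c \<le> n y" by (rule ge)
      then show ?thesis using \<open>0 < c\<close> by (simp add: field_simps)
    qed
    have "sublinear n"
      unfolding sublinear_def
    proof (intro conjI allI impI)
      fix y z
      have "n (y + z) - (m (z + t *\<^sub>R a) - t * m a) \<le> n y" if t: "0 \<le> t" for t
      proof (rule ge)
        fix s :: real assume s: "0 \<le> s"
        have "n (y + z) \<le> m ((y + z) + (s + t) *\<^sub>R a) - (s + t) * m a"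
          by (rule le) (use s t in simp)
        also have "(y + z) + (s + t) *\<^sub>R a = (y + s *\<^sub>R a) + (z + t *\<^sub>R a)"
          by (simp add: scaleR_add_left)
        also have "m \<dots> \<le> m (y + s *\<^sub>R a) + m (z + t *\<^sub>R a)"
          by (rule sublinearD(1)[OF m])
        finally show "n (y + z) - (m (z + t *\<^sub>R a) - t * m a) \<le> m (y + s *\<^sub>R a) - s * m a"
          by (simp add: algebra_simps)
      qed
      then have "n (y + z) - n y \<le> n z" by (intro ge) (simp add: algebra_simps)
      then show "n (y + z) \<le> n y + n z" by simp
    next
      fix c :: real and y assume "0 < c"
      have "n ((1 / c) *\<^sub>R (c *\<^sub>R y)) \<le> (1 / c) * n (c *\<^sub>R y)"
        by (rule n_scale_le) (use \<open>0 < c\<close> in simp)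
      then have "c * n y \<le> n (c *\<^sub>R y)"
        using \<open>0 < c\<close> by (simp add: field_simps)
      with n_scale_le[OF \<open>0 < c\<close>, of y] show "n (c *\<^sub>R y) = c * n y" by simp
    qed
    moreover have "n y \<le> m y" for y
      using le[of 0 y] by simp
    ultimately have "n = m" by (rule min)
    with le[of 1 x] show ?thesis by simp
  qed
  have add: "m (x + y) = m x + m y" for x y
    using add_ge[of x y] sublinearD(1)[OF m, of x y] by simp
  have zero: "m 0 = 0" using add[of 0 0] by simp
  have minus: "m (- x) = - m x" for x
    using add[of x "- x"] zero by simp
  show ?thesis
  proof (rule linearI)
    fix c :: real and x
    show "m (c *\<^sub>R x) = c *\<^sub>R m x"
    proof (cases "0 \<le> c")
      case True
      then show ?thesis using sublinearD(2)[OF m] by simp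
    next
      case False
      then have "m ((- c) *\<^sub>R x) = (- c) * m x"
        by (intro sublinearD(2)[OF m]) simp
      then show ?thesis using minus[of "c *\<^sub>R x"] by simp
    qed
  qed (rule add)
qed

text \<open>The Hahn--Banach theorem in the form due to Koenig: Zorn's lemma is applied to the sublinear
  functionals themselves, ordered pointwise, so that no extension from subspaces is involved.\<close>

theorem linear_below_sublinear:
  fixes S :: "'v::real_vector \<Rightarrow> real"
  assumes S: "sublinear S"
  shows "\<exists>L. linear L \<and> (\<forall>x. L x \<le> S x)"
proof -
  define A where "A = {q. sublinear q \<and> (\<forall>x. q x \<le> S x)}"
  define P where "P = (\<lambda>a b :: 'v \<Rightarrow> real. b \<le> a)"
  have "\<exists>m\<in>A. \<forall>a\<in>A. P m a \<longrightarrow> a = m"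
  proof (rule predicate_Zorn)
    show "partial_order_on A (relation_of P A)"
      by (rule partial_order_on_relation_ofI) (auto simp: P_def)
  next
    fix C assume C: "C \<in> Chains (relation_of P A)"
    then have CA: "C \<subseteq> A" and chain: "\<And>a b. a \<in> C \<Longrightarrow> b \<in> C \<Longrightarrow> a \<le> b \<or> b \<le> a"
      by (auto simp: Chains_def relation_of_def P_def)
    show "\<exists>u\<in>A. \<forall>a\<in>C. P a u"
    proof (cases "C = {}")
      case True
      then show ?thesis using S by (auto simp: A_def)
    next
      case False
      define u where "u x = (INF q\<in>C. q x)" for x
      have bdd: "bdd_below ((\<lambda>q. q x) ` C)" for x
      proof (rule bdd_belowI2)
        fix q assume "q \<in> C"
        then have q: "sublinear q" "q (- x) \<le> S (- x)" using CA by (auto simp: A_def)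
        show "- S (- x) \<le> q x" using sublinearD(3)[OF q(1), of x] q(2) by simp
      qed
      have le: "u x \<le> q x" if "q \<in> C" for q x
        unfolding u_def by (rule cINF_lower[OF bdd that])
      have ge: "z \<le> u x" if "\<And>q. q \<in> C \<Longrightarrow> z \<le> q x" for z x
        unfolding u_def by (rule cINF_greatest[OF False that])
      have sub: "sublinear q" if "q \<in> C" for q using that CA by (auto simp: A_def)
      have "sublinear u"
        unfolding sublinear_def
      proof (intro conjI allI impI)
        fix x y
        \<comment> \<open>Two members of a chain are comparable, so the smaller one bounds both summands.\<close>
        have mixed: "u (x + y) \<le> q x + r y" if qr: "q \<in> C" "r \<in> C" for q r
        proof -
          obtain s where s: "s \<in> C" "s \<le> q" "s \<le> r"
            using chain[OF qr] qr by (meson order_refl)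
          have "u (x + y) \<le> s (x + y)" by (rule le[OF s(1)])
          also have "\<dots> \<le> s x + s y" by (rule sublinearD(1)[OF sub[OF s(1)]])
          also have "\<dots> \<le> q x + r y" using s by (intro add_mono) (auto simp: le_fun_def)
          finally show ?thesis .
        qed
        have "u (x + y) - q x \<le> u y" if "q \<in> C" for q
        proof (rule ge)
          fix r assume "r \<in> C"
          with mixed[OF that this] show "u (x + y) - q x \<le> r y" by simp
        qed
        then have "u (x + y) - u y \<le> u x" by (intro ge) (simp add: algebra_simps)
        then show "u (x + y) \<le> u x + u y" by simp
      next
        fix c :: real and x assume c: "0 < c"
        have "u (c *\<^sub>R x) / c \<le> u x"
          using le[of _ "c *\<^sub>R x"] sublinearD(2)[OF sub, of _ c x] c
          by (intro ge) (fastforce simp: field_simps)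
        moreover have "c * u x \<le> u (c *\<^sub>R x)"
        proof (rule ge)
          fix q assume q: "q \<in> C"
          show "c * u x \<le> q (c *\<^sub>R x)"
            using le[OF q, of x] sublinearD(2)[OF sub[OF q], of c x] c by (simp add: mult_left_mono)
        qed
        ultimately show "u (c *\<^sub>R x) = c * u x" using c by (simp add: field_simps)
      qed
      moreover obtain q where "q \<in> C" "q \<in> A" using False CA by blast
      then have "u x \<le> S x" for x
        using le[of q x] by (auto simp: A_def intro: order_trans)
      ultimately have "u \<in> A" by (simp add: A_def)
      then show ?thesis using le by (auto simp: P_def le_fun_def)
    qed
  qed
  then obtain m where m: "m \<in> A" "\<And>a. a \<in> A \<Longrightarrow> a \<le> m \<Longrightarrow> a = m"
    by (auto simp: P_def)
  have "linear m"
  proof (rule linear_if_minimal_sublinear)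
    fix q assume "sublinear q" "\<And>x. q x \<le> m x"
    then show "q = m" using m by (intro m(2)) (auto simp: A_def le_fun_def intro: order_trans)
  qed (use m(1) in \<open>auto simp: A_def\<close>)
  then show ?thesis using m(1) by (auto simp: A_def)
qed

section \<open>Topologies and their Borel sets\<close>

lemma space_borel_of [simp]: "space (borel_of T) = topspace T"
  by (simp add: borel_of_def space_measure_of_conv)

lemma sets_borel_of: "sets (borel_of T) = sigma_sets (topspace T) {U. openin T U}"
  unfolding borel_of_def by (rule sets_measure_of) (auto dest: openin_subset)

lemma openin_borel_of: "openin T U \<Longrightarrow> U \<in> sets (borel_of T)"
  by (auto simp: sets_borel_of)

lemma closedin_borel_of:
  assumes "closedin T C" shows "C \<in> sets (borel_of T)"
proof -
  have "space (borel_of T) - (topspace T - C) \<in> sets (borel_of T)"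
    using assms by (intro sets.compl_sets openin_borel_of) auto
  then show ?thesis using closedin_subset[OF assms] by (simp add: double_diff)
qed

lemma measurable_borel_of:
  assumes "continuous_map T T' f"
  shows "f \<in> measurable (borel_of T) (borel_of T')"
  unfolding borel_of_def[of T']
proof (rule measurable_measure_of)
  fix U assume "U \<in> {U. openin T' U}"
  then have "openin T {x \<in> topspace T. f x \<in> U}"
    using assms by (auto simp: continuous_map_def)
  then show "f -` U \<inter> space (borel_of T) \<in> sets (borel_of T)"
    by (intro openin_borel_of) (simp add: vimage_def Int_def conj_commute)
qed (use assms in \<open>auto dest: openin_subset simp: continuous_map_def\<close>)

lemma borel_measurable_borel_of:
  fixes u :: "'a \<Rightarrow> real"
  assumes "\<And>a. openin T {x \<in> topspace T. a < u x}"
  shows "u \<in> borel_measurable (borel_of T)"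
  by (rule borel_measurable_iff_greater[THEN iffD2]) (simp add: openin_borel_of assms)

lemma openin_greater_continuous:
  assumes "continuous_map T euclideanreal f"
  shows "openin T {x \<in> topspace T. a < f x}"
  using openin_continuous_map_preimage[OF assms, of "{a<..}"] by simp

text \<open>Openness of all sets \<open>{x. a < u x}\<close> is lower semicontinuity of \<open>u\<close>.  It is kept in this
  unfolded form here and below.\<close>
lemma openin_greater_add:
  fixes u w :: "'a \<Rightarrow> real"
  assumes "\<And>a. openin T {x \<in> topspace T. a < u x}" and "\<And>a. openin T {x \<in> topspace T. a < w x}"
  shows "openin T {x \<in> topspace T. a < u x + w x}"
proof -
  have "{x \<in> topspace T. a < u x + w x} =
    (\<Union>q. {x \<in> topspace T. q < u x} \<inter> {x \<in> topspace T. a - q < w x})"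
  proof (intro set_eqI iffI)
    fix x assume "x \<in> {x \<in> topspace T. a < u x + w x}"
    then have "(u x + (a - w x)) / 2 < u x" "a - (u x + (a - w x)) / 2 < w x" "x \<in> topspace T"
      by (auto simp: field_simps)
    then show "x \<in> (\<Union>q. {x \<in> topspace T. q < u x} \<inter> {x \<in> topspace T. a - q < w x})"
      by blast
  qed auto
  also have "openin T \<dots>" using assms by (intro openin_Union openin_Int) auto
  finally show ?thesis .
qed

lemma openin_greater_scale:
  fixes u :: "'a \<Rightarrow> real"
  assumes "\<And>a. openin T {x \<in> topspace T. a < u x}" and "0 < c"
  shows "openin T {x \<in> topspace T. a < c * u x}"
proof -
  have "{x \<in> topspace T. a < c * u x} = {x \<in> topspace T. a / c < u x}"
    using assms(2) by (auto simp: field_simps)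
  then show ?thesis using assms(1) by simp
qed

text \<open>The two compact sets \<open>K - U\<close> and \<open>K - V\<close> are disjoint, hence have disjoint open
  neighbourhoods; removing these from \<open>K\<close> leaves the two pieces.\<close>
lemma compactin_split:
  assumes T: "Hausdorff_space T" and K: "compactin T K"
    and U: "openin T U" and V: "openin T V" and KUV: "K \<subseteq> U \<union> V"
  shows "\<exists>K1 K2. compactin T K1 \<and> compactin T K2 \<and> K1 \<subseteq> U \<and> K2 \<subseteq> V \<and> K = K1 \<union> K2"
proof -
  have cl: "compactin T (K - W)" if "openin T W" for W
    using that by (intro closed_compactin[OF K]) (auto intro: compactin_imp_closedin[OF T K])
  have "disjnt (K - U) (K - V)" using KUV by (auto simp: disjnt_def)
  then obtain U' V' where W: "openin T U'" "openin T V'" "K - U \<subseteq> U'" "K - V \<subseteq> V'" "disjnt U' V'"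
    using Hausdorff_space_compact_separation[OF T cl[OF U] cl[OF V]] by metis
  then show ?thesis
    by (intro exI[of _ "K - U'"] exI[of _ "K - V'"]) (auto simp: cl disjnt_def)
qed

section \<open>Radon measures from tight finitely additive set functions\<close>

text \<open>A finitely additive set function is turned into a measure in the manner of the Riesz
  representation theorem: an open set gets the supremum of the values on its compact subsets, and
  Caratheodory's construction does the rest.  Passing through compact sets produces countable
  subadditivity on open sets from mere finite additivity.  Regularisation can only decrease the
  values of open sets; tightness ensures that the total mass is not decreased, and therefore that the
  values of closed sets can only increase.\<close>

locale tight_charge =
  fixes T :: "'b topology" and lam :: "'b set \<Rightarrow> real"
  assumes Hausdorff: "Hausdorff_space T"
    and nonneg: "\<And>A. 0 \<le> lam A"
    and additive: "\<And>A B. A \<inter> B = {} \<Longrightarrow> lam (A \<union> B) = lam A + lam B"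
    and tight: "\<And>\<epsilon>. 0 < \<epsilon> \<Longrightarrow> \<exists>K. compactin T K \<and> lam (topspace T - K) < \<epsilon>"
begin

definition content :: "'b set \<Rightarrow> ennreal" where
  "content U = (SUP K\<in>{K. compactin T K \<and> K \<subseteq> U}. ennreal (lam K))"

definition outer :: "'b set \<Rightarrow> ennreal" where
  "outer A = (INF U\<in>{U. openin T U \<and> A \<subseteq> U}. content U)"

definition regularisation :: "'b measure" where
  "regularisation = measure_of (topspace T) {U. openin T U} outer"

lemma mono: "A \<subseteq> B \<Longrightarrow> lam A \<le> lam B"
  using additive[of A "B - A"] nonneg[of "B - A"] by (simp add: Un_absorb1)

lemma empty [simp]: "lam {} = 0"
  using additive[of "{}" "{}"] by simp

lemma subadditive: "lam (A \<union> B) \<le> lam A + lam B"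
  using additive[of A "B - A"] mono[of "B - A" B] by simp

lemma content_upper: "compactin T K \<Longrightarrow> K \<subseteq> U \<Longrightarrow> ennreal (lam K) \<le> content U"
  unfolding content_def by (rule SUP_upper) simp

lemma content_least: "(\<And>K. compactin T K \<Longrightarrow> K \<subseteq> U \<Longrightarrow> ennreal (lam K) \<le> z) \<Longrightarrow> content U \<le> z"
  unfolding content_def by (rule SUP_least) simp

lemma content_le: "content U \<le> ennreal (lam U)"
  by (rule content_least) (intro ennreal_leI mono)

lemma content_mono: "U \<subseteq> V \<Longrightarrow> content U \<le> content V"
  by (rule content_least) (auto intro: content_upper)

lemma content_empty [simp]: "content {} = 0"
  using content_le[of "{}"] by simp

lemma content_approx:
  assumes "0 < e"
  shows "\<exists>K. compactin T K \<and> K \<subseteq> U \<and> content U \<le> ennreal (lam K) + ennreal e"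
proof -
  have "content U \<noteq> \<infinity>" using content_le[of U] by (auto simp: top_unique)
  from SUP_approx_ennreal[OF _ _ content_def this, of e] assms
  show ?thesis by (auto intro: less_imp_le)
qed

lemma content_Un:
  assumes "openin T U" "openin T V"
  shows "content (U \<union> V) \<le> content U + content V"
proof (rule content_least)
  fix K assume "compactin T K" "K \<subseteq> U \<union> V"
  then obtain K1 K2 where K: "compactin T K1" "compactin T K2" "K1 \<subseteq> U" "K2 \<subseteq> V" "K = K1 \<union> K2"
    using compactin_split[OF Hausdorff _ assms] by blast
  have "ennreal (lam K) \<le> ennreal (lam K1 + lam K2)"
    using subadditive[of K1 K2] K(5) by (simp add: ennreal_leI)
  also have "\<dots> = ennreal (lam K1) + ennreal (lam K2)" using nonneg by simp
  also have "\<dots> \<le> content U + content V" using K by (intro add_mono content_upper)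
  finally show "ennreal (lam K) \<le> content U + content V" .
qed

lemma content_UN:
  fixes U :: "nat \<Rightarrow> 'b set"
  assumes U: "\<And>n. openin T (U n)"
  shows "content (\<Union>n. U n) \<le> (\<Sum>n. content (U n))"
proof (rule content_least)
  fix K assume K: "compactin T K" "K \<subseteq> (\<Union>n. U n)"
  have fin: "content (\<Union>i<n. U i) \<le> (\<Sum>i<n. content (U i))" for n
  proof (induction n)
    case (Suc n)
    have "content (\<Union>i<Suc n. U i) = content ((\<Union>i<n. U i) \<union> U n)"
      by (simp add: lessThan_Suc Un_commute)
    also have "\<dots> \<le> content (\<Union>i<n. U i) + content (U n)" using U by (intro content_Un) auto
    also have "\<dots> \<le> (\<Sum>i<Suc n. content (U i))" using Suc by (simp add: add_right_mono)
    finally show ?case .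
  qed simp
  obtain F where F: "finite F" "F \<subseteq> range U" "K \<subseteq> \<Union>F"
    using K U unfolding compactin_def by (metis (no_types, lifting) imageE)
  then obtain I where I: "finite I" "F = U ` I" by (auto dest: finite_subset_image)
  then obtain n where n: "I \<subseteq> {..<n}" by (auto dest: finite_nat_iff_bounded[THEN iffD1])
  have "ennreal (lam K) \<le> content (\<Union>i<n. U i)" using K F I n by (intro content_upper) blast+
  also have "\<dots> \<le> (\<Sum>i<n. content (U i))" by (rule fin)
  also have "\<dots> \<le> (\<Sum>n. content (U n))" by (rule sum_le_suminf) auto
  finally show "ennreal (lam K) \<le> (\<Sum>n. content (U n))" .
qed

lemma outer_lower: "openin T U \<Longrightarrow> A \<subseteq> U \<Longrightarrow> outer A \<le> content U"
  unfolding outer_def by (rule INF_lower) simp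

lemma outer_greatest: "(\<And>U. openin T U \<Longrightarrow> A \<subseteq> U \<Longrightarrow> z \<le> content U) \<Longrightarrow> z \<le> outer A"
  unfolding outer_def by (rule INF_greatest) simp

lemma outer_openin: "openin T U \<Longrightarrow> outer U = content U"
  by (intro antisym outer_lower outer_greatest content_mono) auto

lemma outer_mono: "A \<subseteq> B \<Longrightarrow> outer A \<le> outer B"
  by (rule outer_greatest) (auto intro: outer_lower)

lemma outer_approx:
  assumes "0 < e" "A \<subseteq> topspace T"
  shows "\<exists>U. openin T U \<and> A \<subseteq> U \<and> content U < outer A + ennreal e"
proof -
  have "outer A \<le> content (topspace T)" using assms by (intro outer_lower) auto
  also have "\<dots> < top" using content_le[of "topspace T"] by (simp add: le_less_trans)
  finally have "outer A \<noteq> \<infinity>" by auto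
  from INF_approx_ennreal[OF _ outer_def this, of e] assms show ?thesis by auto
qed

lemma outer_measure_space: "outer_measure_space (Pow (topspace T)) outer"
  unfolding outer_measure_space_def
proof (intro conjI)
  show "positive (Pow (topspace T)) outer"
    by (simp add: positive_def outer_openin)
  show "increasing (Pow (topspace T)) outer"
    by (simp add: increasing_def outer_mono)
  show "countably_subadditive (Pow (topspace T)) outer"
    unfolding countably_subadditive_def
  proof (intro allI impI)
    fix A :: "nat \<Rightarrow> 'b set" assume A: "range A \<subseteq> Pow (topspace T)"
    show "outer (\<Union>i. A i) \<le> (\<Sum>i. outer (A i))"
    proof (rule ennreal_le_epsilon)
      fix e :: real assume e: "0 < e"
      have "\<exists>U. openin T U \<and> A n \<subseteq> U \<and> content U < outer (A n) + ennreal (e * (1/2)^Suc n)" for n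
        by (rule outer_approx) (use e A in auto)
      then obtain U where U: "\<And>n. openin T (U n)" "\<And>n. A n \<subseteq> U n"
          "\<And>n. content (U n) < outer (A n) + ennreal (e * (1/2)^Suc n)"
        by metis
      have "outer (\<Union>i. A i) \<le> content (\<Union>n. U n)"
        using U by (intro outer_lower) auto
      also have "\<dots> \<le> (\<Sum>n. content (U n))" by (rule content_UN) (rule U)
      also have "\<dots> \<le> (\<Sum>n. outer (A n) + ennreal (e * (1/2)^Suc n))"
        using U(3) by (intro suminf_le) (auto intro: less_imp_le)
      also have "\<dots> = (\<Sum>n. outer (A n)) + (\<Sum>n. ennreal (e * (1/2)^Suc n))"
        by (rule suminf_add[symmetric]) auto
      also have "(\<Sum>n. ennreal (e * (1/2)^Suc n)) = ennreal e"
        using e sums_mult[OF power_half_series, of e]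
        by (intro suminf_ennreal_eq) auto
      finally show "outer (\<Union>i. A i) \<le> (\<Sum>i. outer (A i)) + ennreal e" .
    qed
  qed
qed

text \<open>For an open \<open>W\<close> containing \<open>A\<close>, nearly optimal compact sets are chosen first in \<open>U \<inter> W\<close> and
  then in the open rest of \<open>W\<close>.  They are disjoint, so that additivity of \<open>lam\<close> applies to them.\<close>
lemma openin_caratheodory:
  assumes U: "openin T U"
  shows "U \<in> lambda_system (topspace T) (Pow (topspace T)) outer"
proof -
  have "outer (U \<inter> A) + outer ((topspace T - U) \<inter> A) = outer A" if A: "A \<subseteq> topspace T" for A
  proof (rule antisym)
    show "outer (U \<inter> A) + outer ((topspace T - U) \<inter> A) \<le> outer A"
    proof (rule outer_greatest)
      fix W assume W: "openin T W" "A \<subseteq> W"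
      show "outer (U \<inter> A) + outer ((topspace T - U) \<inter> A) \<le> content W"
      proof (rule ennreal_le_epsilon)
        fix e :: real assume e: "0 < e"
        obtain K where K: "compactin T K" "K \<subseteq> U \<inter> W"
            "content (U \<inter> W) \<le> ennreal (lam K) + ennreal (e / 2)"
          using content_approx[of "e / 2" "U \<inter> W"] e by auto
        have WK: "openin T (W - K)"
          using W compactin_imp_closedin[OF Hausdorff K(1)] by auto
        obtain K' where K': "compactin T K'" "K' \<subseteq> W - K"
            "content (W - K) \<le> ennreal (lam K') + ennreal (e / 2)"
          using content_approx[of "e / 2" "W - K"] e by auto
        have "outer (U \<inter> A) + outer ((topspace T - U) \<inter> A) \<le> content (U \<inter> W) + content (W - K)"
          using W U K WK by (intro add_mono outer_lower) auto
        also have "\<dots> \<le> (ennreal (lam K) + ennreal (e / 2)) + (ennreal (lam K') + ennreal (e / 2))"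
          by (intro add_mono K K')
        also have "\<dots> = ennreal (lam (K \<union> K')) + ennreal e"
          using K K' nonneg e by (subst additive) (auto simp flip: ennreal_plus)
        also have "\<dots> \<le> content W + ennreal e"
          using K K' by (intro add_right_mono content_upper compactin_Un) auto
        finally show "outer (U \<inter> A) + outer ((topspace T - U) \<inter> A) \<le> content W + ennreal e" .
      qed
    qed
  next
    have "outer A \<le> outer (U \<inter> A) + outer ((topspace T - U) \<inter> A) + ennreal e" if e: "0 < e" for e
    proof -
      obtain V where V: "openin T V" "U \<inter> A \<subseteq> V" "content V < outer (U \<inter> A) + ennreal (e / 2)"
        using outer_approx[of "e / 2" "U \<inter> A"] e A by auto
      obtain V' where V': "openin T V'" "(topspace T - U) \<inter> A \<subseteq> V'"
          "content V' < outer ((topspace T - U) \<inter> A) + ennreal (e / 2)"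
        using outer_approx[of "e / 2" "(topspace T - U) \<inter> A"] e A by auto
      have "outer A \<le> content (V \<union> V')" using A V V' by (intro outer_lower) auto
      also have "\<dots> \<le> content V + content V'" using V V' by (intro content_Un)
      also have "\<dots> \<le> (outer (U \<inter> A) + ennreal (e / 2)) + (outer ((topspace T - U) \<inter> A) + ennreal (e / 2))"
        using V V' by (intro add_mono) auto
      also have "\<dots> = outer (U \<inter> A) + outer ((topspace T - U) \<inter> A) + (ennreal (e / 2) + ennreal (e / 2))"
        by (simp add: ac_simps)
      also have "ennreal (e / 2) + ennreal (e / 2) = ennreal e"
        using e by (simp flip: ennreal_plus)
      finally show ?thesis .
    qed
    then show "outer A \<le> outer (U \<inter> A) + outer ((topspace T - U) \<inter> A)"
      by (rule ennreal_le_epsilon)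
  qed
  then show ?thesis using openin_subset[OF U] by (auto simp: lambda_system_def)
qed

lemma space_regularisation: "space regularisation = topspace T"
  and sets_regularisation: "sets regularisation = sets (borel_of T)"
  unfolding regularisation_def sets_borel_of
  by (auto intro!: sets_measure_of simp: space_measure_of_conv dest: openin_subset)

lemma emeasure_regularisation:
  assumes "A \<in> sets (borel_of T)"
  shows "emeasure regularisation A = outer A"
proof -
  let ?L = "lambda_system (topspace T) (Pow (topspace T)) outer"
  interpret Pow: sigma_algebra "topspace T" "Pow (topspace T)" by (rule sigma_algebra_Pow)
  have L: "measure_space (topspace T) ?L outer"
    by (rule Pow.caratheodory_lemma[OF outer_measure_space])
  then interpret L: sigma_algebra "topspace T" ?L by (simp add: measure_space_def)
  have sub: "sets (borel_of T) \<subseteq> ?L"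
    unfolding sets_borel_of by (rule L.sigma_sets_subset) (auto intro: openin_caratheodory)
  show ?thesis
  proof (rule emeasure_measure_of[OF regularisation_def])
    show "positive (sets regularisation) outer"
      by (simp add: positive_def outer_openin)
    show "countably_additive (sets regularisation) outer"
      using L sub unfolding sets_regularisation measure_space_def countably_additive_def
      by (meson subsetD subset_trans)
  qed (use assms in \<open>auto simp: sets_regularisation dest: openin_subset\<close>)
qed

lemma emeasure_regularisation_openin_le:
  assumes "openin T U" shows "emeasure regularisation U \<le> ennreal (lam U)"
  using assms content_le[of U] by (simp add: emeasure_regularisation openin_borel_of outer_openin)

lemma emeasure_regularisation_space:
  "emeasure regularisation (topspace T) = ennreal (lam (topspace T))"
proof (rule antisym)
  show "ennreal (lam (topspace T)) \<le> emeasure regularisation (topspace T)"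
  proof (rule ennreal_le_epsilon)
    fix e :: real assume "0 < e"
    with tight obtain K where K: "compactin T K" "lam (topspace T - K) < e" by blast
    have "lam (topspace T) \<le> lam K + e"
      using K additive[of K "topspace T - K"] compactin_subset_topspace[OF K(1)]
      by (simp add: Un_absorb1)
    then have "ennreal (lam (topspace T)) \<le> ennreal (lam K) + ennreal e"
      using nonneg[of K] \<open>0 < e\<close> by (simp add: ennreal_leI flip: ennreal_plus)
    also have "\<dots> \<le> content (topspace T) + ennreal e"
      using K by (intro add_right_mono content_upper) (auto dest: compactin_subset_topspace)
    also have "content (topspace T) = emeasure regularisation (topspace T)"
      by (simp add: emeasure_regularisation openin_borel_of outer_openin)
    finally show "ennreal (lam (topspace T)) \<le> emeasure regularisation (topspace T) + ennreal e" .
  qed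
qed (simp add: emeasure_regularisation_openin_le)

lemma finite_measure_regularisation: "finite_measure regularisation"
  by (rule finite_measureI) (simp add: space_regularisation emeasure_regularisation_space)

text \<open>The bound for open sets, applied to the complement, as the total masses agree.\<close>
lemma emeasure_regularisation_closedin_ge:
  assumes C: "closedin T C" shows "ennreal (lam C) \<le> emeasure regularisation C"
proof -
  interpret finite_measure regularisation by (rule finite_measure_regularisation)
  have CT: "C \<subseteq> topspace T" by (rule closedin_subset[OF C])
  have "emeasure regularisation C = emeasure regularisation (topspace T - (topspace T - C))"
    using CT by (simp add: double_diff)
  also have "\<dots> = emeasure regularisation (topspace T) - emeasure regularisation (topspace T - C)"
    using C by (intro emeasure_Diff)
      (auto simp: sets_regularisation openin_borel_of openin_diff emeasure_eq_measure)
  also have "\<dots> \<ge> ennreal (lam (topspace T)) - ennreal (lam (topspace T - C))"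
    using C by (intro ennreal_minus_mono emeasure_regularisation_openin_le)
      (auto simp: emeasure_regularisation_space)
  also have "ennreal (lam (topspace T)) - ennreal (lam (topspace T - C)) = ennreal (lam C)"
    using additive[of C "topspace T - C"] CT nonneg
    by (simp add: Un_absorb1 ennreal_minus)
  finally show ?thesis .
qed

text \<open>Outer regularity, which holds by construction, becomes inner regularity for closed sets by
  taking complements, and tightness replaces closed sets by compact ones.\<close>
theorem radon_regularisation: "radon_measure T regularisation"
  unfolding radon_measure_def
proof (intro conjI ballI allI impI sets_regularisation)
  interpret finite_measure regularisation by (rule finite_measure_regularisation)
  fix B and \<epsilon> :: real assume B: "B \<in> sets regularisation" and \<epsilon>: "0 < \<epsilon>"
  have BT: "B \<subseteq> topspace T" using sets.sets_into_space[OF B] by (simp add: space_regularisation)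
  obtain U where U: "openin T U" "topspace T - B \<subseteq> U"
      "content U < outer (topspace T - B) + ennreal (\<epsilon> / 2)"
    using outer_approx[of "\<epsilon> / 2" "topspace T - B"] \<epsilon> by auto
  have cB: "topspace T - B \<in> sets regularisation"
    using sets.compl_sets[OF B] by (simp add: space_regularisation)
  have Us: "U \<in> sets regularisation" using U by (simp add: sets_regularisation openin_borel_of)
  have "emeasure regularisation U < emeasure regularisation (topspace T - B) + ennreal (\<epsilon> / 2)"
    using U cB Us by (simp add: emeasure_regularisation sets_regularisation outer_openin)
  then have "measure regularisation U < measure regularisation (topspace T - B) + \<epsilon> / 2"
    using \<epsilon> by (simp add: emeasure_eq_measure ennreal_less_iff flip: ennreal_plus)
  then have 1: "measure regularisation (U - (topspace T - B)) < \<epsilon> / 2"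
    using U Us cB by (subst finite_measure_Diff) auto
  obtain K where K: "compactin T K" "lam (topspace T - K) < \<epsilon> / 2"
    using tight[of "\<epsilon> / 2"] \<epsilon> by auto
  have clK: "closedin T K" by (rule compactin_imp_closedin[OF Hausdorff K(1)])
  have "emeasure regularisation (topspace T - K) \<le> ennreal (lam (topspace T - K))"
    using clK by (intro emeasure_regularisation_openin_le) auto
  then have "measure regularisation (topspace T - K) \<le> lam (topspace T - K)"
    using nonneg by (simp add: emeasure_eq_measure)
  then have 2: "measure regularisation (topspace T - K) < \<epsilon> / 2" using K by simp
  have cpt: "compactin T (K - U)"
    using U clK by (intro closed_compactin[OF K(1)]) auto
  have KU: "K - U \<in> sets regularisation"
    unfolding sets_regularisation by (rule closedin_borel_of[OF compactin_imp_closedin[OF Hausdorff cpt]])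
  have cK: "topspace T - K \<in> sets regularisation"
    unfolding sets_regularisation using clK by (intro openin_borel_of) auto
  have "measure regularisation (B - (K - U))
      \<le> measure regularisation ((U - (topspace T - B)) \<union> (topspace T - K))"
    using BT B KU Us cB cK by (intro finite_measure_mono) auto
  also have "\<dots> \<le> measure regularisation (U - (topspace T - B)) + measure regularisation (topspace T - K)"
    using Us cB cK by (intro measure_subadditive) (auto simp: emeasure_eq_measure)
  also have "\<dots> < \<epsilon>" using 1 2 by simp
  finally have "emeasure regularisation (B - (K - U)) < ennreal \<epsilon>"
    by (simp add: emeasure_eq_measure ennreal_lessI \<epsilon>)
  moreover have "K - U \<subseteq> B" using U compactin_subset_topspace[OF K(1)] by auto
  ultimately show "\<exists>K\<subseteq>B. compactin T K \<and> K \<in> sets regularisation \<and>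
      emeasure regularisation (B - K) < ennreal \<epsilon>"
    using cpt KU by blast
qed

end

section \<open>Radon measures and compact sets\<close>

lemma radon_measure_exhaustion:
  assumes M: "radon_measure T M" and A: "A \<in> sets M"
  shows "\<exists>K :: nat \<Rightarrow> 'a set. incseq K \<and> (\<forall>n. compactin T (K n) \<and> K n \<in> sets M \<and> K n \<subseteq> A) \<and>
    A - (\<Union>n. K n) \<in> null_sets M"
proof -
  have "\<exists>K. K \<subseteq> A \<and> compactin T K \<and> K \<in> sets M \<and> emeasure M (A - K) < ennreal (1 / Suc n)" for n
    using M A ennreal_less_zero_iff unfolding radon_measure_def
    by (metis divide_pos_pos of_nat_0_less_iff zero_less_Suc zero_less_one)
  then obtain C where C: "\<And>n. C n \<subseteq> A" "\<And>n. compactin T (C n)" "\<And>n. C n \<in> sets M"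
      "\<And>n. emeasure M (A - C n) < ennreal (1 / Suc n)"
    by metis
  define K where "K n = (\<Union>i\<le>n. C i)" for n
  have UK: "(\<Union>n. K n) = (\<Union>n. C n)" by (auto simp: K_def)
  have le: "emeasure M (A - (\<Union>n. K n)) \<le> ennreal (1 / Suc n)" for n
    using C(4)[of n] C(3) A UK
    by (intro order_trans[OF emeasure_mono less_imp_le[OF C(4)[of n]]]) auto
  have "(\<lambda>n. ennreal (1 / Suc n)) \<longlonglongrightarrow> ennreal 0"
    by (intro tendsto_ennrealI) (rule lim_1_over_n[THEN LIMSEQ_Suc])
  then have "emeasure M (A - (\<Union>n. K n)) \<le> ennreal 0"
    by (rule LIMSEQ_le_const) (use le in auto)
  then have "A - (\<Union>n. K n) \<in> null_sets M"
    using A C(3) by (intro null_setsI) (auto simp: UK)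
  moreover have "incseq K" by (force simp: incseq_def K_def)
  moreover have "compactin T (K n)" for n
    unfolding K_def by (rule compactin_Union) (use C in auto)
  ultimately show ?thesis
    using C by (intro exI[of _ K]) (auto simp: K_def)
qed

text \<open>Up to a null set of \<open>M\<close>, which is also null for the density, \<open>A\<close> is an increasing union of
  compact sets.\<close>
lemma emeasure_density_le_of_compact:
  assumes M: "radon_measure T M" and N: "sets N = sets M" and f: "f \<in> borel_measurable M"
    and le: "\<And>K. compactin T K \<Longrightarrow> K \<in> sets M \<Longrightarrow> emeasure (density M f) K \<le> emeasure N K"
    and A: "A \<in> sets M"
  shows "emeasure (density M f) A \<le> emeasure N A"
proof -
  obtain K where K: "incseq K" "\<And>n. compactin T (K n)" "\<And>n. K n \<in> sets M" "\<And>n. K n \<subseteq> A"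
      "A - (\<Union>n. K n) \<in> null_sets M"
    using radon_measure_exhaustion[OF M A] by blast
  have "A - (\<Union>n. K n) \<in> null_sets (density M f)"
    using absolutely_continuousI_density[OF f] K(5) by (auto simp: absolutely_continuous_def)
  then have "emeasure (density M f) ((\<Union>n. K n) \<union> (A - (\<Union>n. K n))) = emeasure (density M f) (\<Union>n. K n)"
    using K(3) by (intro emeasure_Un_null_set) auto
  moreover have "(\<Union>n. K n) \<union> (A - (\<Union>n. K n)) = A" using K(4) by auto
  ultimately have "emeasure (density M f) A = emeasure (density M f) (\<Union>n. K n)" by simp
  also have "\<dots> = (SUP n. emeasure (density M f) (K n))"
    using K by (intro SUP_emeasure_incseq[symmetric]) auto
  also have "\<dots> \<le> emeasure N A"
    using K A N by (intro SUP_least order_trans[OF le emeasure_mono]) auto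
  finally show ?thesis .
qed

text \<open>Complements turn the bound on open sets into the reverse bound on compact sets, hence by inner
  regularity on all Borel sets; applied to a set and its complement, it forces equality because
  the total masses agree.\<close>
lemma radon_measure_eqI:
  assumes T: "Hausdorff_space T" and M: "radon_measure T M" "prob_space M"
    and N: "prob_space N" "sets N = sets M"
    and le: "\<And>U. openin T U \<Longrightarrow> emeasure N U \<le> emeasure M U"
  shows "N = M"
proof (rule measure_eqI)
  interpret M: prob_space M by fact
  interpret N: prob_space N by fact
  have sM: "sets M = sets (borel_of T)" using M by (simp add: radon_measure_def)
  then have sp: "space M = topspace T" by (auto dest: sets_eq_imp_space_eq)
  have sp': "space N = space M" using N(2) by (rule sets_eq_imp_space_eq)
  have ge: "emeasure M A \<le> emeasure N A" if A: "A \<in> sets M" for A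
  proof -
    have "emeasure (density M (\<lambda>_. 1)) A \<le> emeasure N A"
    proof (rule emeasure_density_le_of_compact[OF M(1) N(2) _ _ A])
      fix K assume K: "compactin T K" "K \<in> sets M"
      have "openin T (topspace T - K)" using compactin_imp_closedin[OF T K(1)] by auto
      then have "measure N (space N - K) \<le> measure M (space M - K)"
        using le[of "topspace T - K"] by (simp add: sp sp' M.emeasure_eq_measure N.emeasure_eq_measure)
      then have "measure M K \<le> measure N K"
        using K N by (simp add: M.prob_compl N.prob_compl)
      then show "emeasure (density M (\<lambda>_. 1)) K \<le> emeasure N K"
        by (simp add: density_1 M.emeasure_eq_measure N.emeasure_eq_measure)
    qed simp
    then show ?thesis by (simp add: density_1)
  qed
  fix A assume A: "A \<in> sets N"
  have "measure M A \<le> measure N A" "measure M (space M - A) \<le> measure N (space N - A)"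
    using ge[of A] ge[of "space M - A"] A
    by (auto simp: N(2) sp' M.emeasure_eq_measure N.emeasure_eq_measure)
  then have "measure N A = measure M A"
    using A N(2) by (simp add: M.prob_compl N.prob_compl)
  then show "emeasure N A = emeasure M A"
    by (simp add: M.emeasure_eq_measure N.emeasure_eq_measure)
qed (rule N)

lemma integrable_bounded_mult:
  fixes f h :: "'a \<Rightarrow> real"
  assumes "integrable M f" and "h \<in> borel_measurable M" and "\<And>x. \<bar>h x\<bar> \<le> B"
  shows "integrable M (\<lambda>x. h x * f x)"
proof (rule Bochner_Integration.integrable_bound)
  show "integrable M (\<lambda>x. B * \<bar>f x\<bar>)" using assms by simp
  have "0 \<le> B" using assms(3)[of undefined] by (rule order_trans[OF abs_ge_zero])
  then show "AE x in M. norm (h x * f x) \<le> norm (B * \<bar>f x\<bar>)"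
    using assms(3) by (auto simp: abs_mult intro!: mult_right_mono)
qed (use assms in auto)

section \<open>Duality\<close>

text \<open>In the application \<open>F\<close> is the lattice cone; integrability of its members expresses the growth
  bound in combination with the moment conditions on the two measures.\<close>
locale cone_domination =
  fixes T :: "'a topology" and F :: "('a \<Rightarrow> real) set" and \<mu> \<nu> :: "'a measure"
  assumes topspace_T [simp]: "topspace T = UNIV"
    and Hausdorff: "Hausdorff_space T"
    and prob: "prob_space \<mu>" "prob_space \<nu>"
    and radon: "radon_measure T \<mu>" "radon_measure T \<nu>"
    and const_cone: "\<And>c. (\<lambda>_. c) \<in> F"
    and cone: "\<And>f g a b. f \<in> F \<Longrightarrow> g \<in> F \<Longrightarrow> 0 \<le> a \<Longrightarrow> 0 \<le> b \<Longrightarrow> (\<lambda>x. a * f x + b * g x) \<in> F"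
    and max_cone: "\<And>f g. f \<in> F \<Longrightarrow> g \<in> F \<Longrightarrow> (\<lambda>x. max (f x) (g x)) \<in> F"
    and continuous_cone: "\<And>f. f \<in> F \<Longrightarrow> continuous_map T euclideanreal f"
    and integrable_cone: "\<And>f. f \<in> F \<Longrightarrow> integrable \<mu> f" "\<And>f. f \<in> F \<Longrightarrow> integrable \<nu> f"
    and dominated: "\<And>f. f \<in> F \<Longrightarrow> (\<integral>x. f x \<partial>\<mu>) \<le> (\<integral>x. f x \<partial>\<nu>)"
begin

sublocale mu: prob_space \<mu> by (rule prob)
sublocale nu: prob_space \<nu> by (rule prob)

lemma sets_marginals [simp]: "sets \<mu> = sets (borel_of T)" "sets \<nu> = sets (borel_of T)"
  using radon by (auto simp: radon_measure_def)

lemma space_marginals [simp]: "space \<mu> = UNIV" "space \<nu> = UNIV"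
  using sets_marginals[THEN sets_eq_imp_space_eq] by auto

lemma prob_UNIV [simp]: "measure \<mu> UNIV = 1" "measure \<nu> UNIV = 1"
  using mu.prob_space nu.prob_space by auto

text \<open>For \<open>\<Phi> x = h x * f\<close>, the inequality that the coupling has to satisfy says that
  \<open>\<Phi> x x - \<Phi> x y\<close> has a non-positive integral, so that \<open>\<integral>u d\<mu> + \<integral>v d\<nu>\<close> is an upper bound for the
  integral of \<open>\<phi>\<close>.  Choosing one function of the cone for each point \<open>x\<close> makes sums of such terms
  again terms of the same kind.  Lower semicontinuity of \<open>u\<close> is what the compactness argument in the duality needs;
  it admits constants, indicators of open sets, and \<open>- indicator K * f\<close> for compact \<open>K\<close> and
  non-negative \<open>f\<close> in the cone.\<close>
definition majorised :: "('a \<times> 'a \<Rightarrow> real) \<Rightarrow> ('a \<Rightarrow> real) \<Rightarrow> ('a \<Rightarrow> real) \<Rightarrow> bool" where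
  "majorised \<phi> u v \<longleftrightarrow>
     (\<forall>a. openin T {x \<in> topspace T. a < u x}) \<and> integrable \<mu> u \<and> integrable \<nu> v \<and>
     (\<exists>\<Phi>. (\<forall>x. \<Phi> x \<in> F) \<and> (\<forall>x y. \<phi> (x, y) \<le> u x + v y + \<Phi> x x - \<Phi> x y))"

lemma majorisedI:
  assumes "\<And>a. openin T {x \<in> topspace T. a < u x}" and "integrable \<mu> u" and "integrable \<nu> v"
    and "\<And>x. \<Phi> x \<in> F" and "\<And>x y. \<phi> (x, y) \<le> u x + v y + \<Phi> x x - \<Phi> x y"
  shows "majorised \<phi> u v"
  unfolding majorised_def using assms by blast

lemma Max_in_cone:
  assumes "finite I" "I \<noteq> {}" "\<And>i. i \<in> I \<Longrightarrow> k i \<in> F"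
  shows "(\<lambda>y. MAX i\<in>I. k i y) \<in> F"
  using assms
proof (induction rule: finite_ne_induct)
  case (insert i I)
  then have "(\<lambda>y. max (k i y) (MAX i\<in>I. k i y)) \<in> F" by (intro max_cone) auto
  then show ?case using insert by simp
qed simp

lemma compact_finite_max:
  assumes u: "\<And>a. openin T {x \<in> topspace T. a < u x}"
    and k: "\<And>x. k x \<in> F" "\<And>x. k x x = - u x"
    and K: "compactin T K" and "0 < \<epsilon>"
  shows "\<exists>I. finite I \<and> z \<in> I \<and> (\<forall>y\<in>K. - u y - \<epsilon> \<le> (MAX i\<in>I. k i y))"
proof -
  define O' where "O' x = {y \<in> topspace T. - \<epsilon> < k x y + u y}" for x
  have "openin T (O' x)" for x
    unfolding O'_def
    by (intro openin_greater_add openin_greater_continuous continuous_cone u k)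
  moreover have "K \<subseteq> (\<Union>x. O' x)"
  proof
    fix x assume "x \<in> K"
    have "x \<in> O' x" using k(2) \<open>0 < \<epsilon>\<close> by (simp add: O'_def)
    then show "x \<in> (\<Union>x. O' x)" by blast
  qed
  ultimately obtain W where W: "finite W" "W \<subseteq> range O'" "K \<subseteq> \<Union>W"
    using K unfolding compactin_def by (metis (no_types, lifting) imageE)
  then obtain I where I: "finite I" "W = O' ` I" by (auto dest: finite_subset_image)
  have "- u y - \<epsilon> \<le> (MAX i\<in>insert z I. k i y)" if y: "y \<in> K" for y
  proof -
    obtain i where i: "i \<in> I" "y \<in> O' i" using W I y by blast
    then have "- u y - \<epsilon> \<le> k i y" by (auto simp: O'_def)
    also have "\<dots> \<le> (MAX i\<in>insert z I. k i y)" using I i by (intro Max_ge) auto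
    finally show ?thesis .
  qed
  then show ?thesis using I by (intro exI[of _ "insert z I"]) auto
qed

text \<open>This is the heart of the proof.  The functions \<open>k x = \<Phi> x - (u x + \<Phi> x x)\<close> belong to the cone, lie
  below \<open>v\<close>, and take the value \<open>- u x\<close> at \<open>x\<close>.  So \<open>v\<close> dominates the supremum of all \<open>k x\<close>, which
  dominates \<open>- u\<close>.  If the supremum were in the cone, then the assumption on the cone would give
  \<open>- \<integral>u d\<mu> \<le> \<integral>v d\<nu>\<close>.  On a compact set, finitely many \<open>k x\<close> already exceed \<open>- u - \<epsilon>\<close>, and their maximum
  is in the cone.  Adding one fixed \<open>k z\<close> to them gives an integrable lower bound off the compact
  set, independent of that set, so that the error vanishes as the compact sets exhaust \<open>\<mu>\<close>.\<close>
lemma majorised_zero: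
  assumes "majorised (\<lambda>_. 0) u v"
  shows "0 \<le> (\<integral>x. u x \<partial>\<mu>) + (\<integral>x. v x \<partial>\<nu>)"
proof -
  obtain \<Phi> where u: "\<And>a. openin T {x \<in> topspace T. a < u x}" "integrable \<mu> u"
    and v: "integrable \<nu> v"
    and \<Phi>: "\<And>x. \<Phi> x \<in> F" "\<And>x y. 0 \<le> u x + v y + \<Phi> x x - \<Phi> x y"
    using assms unfolding majorised_def by blast
  define k where "k x y = \<Phi> x y - (u x + \<Phi> x x)" for x y
  have kF: "k x \<in> F" for x
    using cone[OF \<Phi>(1)[of x] const_cone[of "- (u x + \<Phi> x x)"], of 1 1] by (simp add: k_def[abs_def] algebra_simps)
  have kv: "k x y \<le> v y" for x y using \<Phi>(2)[of x y] by (simp add: k_def)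
  have kx: "k x x = - u x" for x by (simp add: k_def)
  define z :: 'a where "z = undefined"
  have bound: "- (\<integral>x. u x \<partial>\<mu>) - \<epsilon> \<le> (\<integral>x. v x \<partial>\<nu>)" if \<epsilon>: "0 < \<epsilon>" for \<epsilon>
  proof -
    obtain K where K: "incseq K" "\<And>n. compactin T (K n)" "\<And>n. K n \<in> sets \<mu>"
        "UNIV - (\<Union>n. K n) \<in> null_sets \<mu>"
      using radon_measure_exhaustion[OF radon(1), of UNIV] sets.top[of \<mu>] by auto
    let ?g = "\<lambda>x. k z x + u x + \<epsilon>"
    have g: "integrable \<mu> ?g"
      using integrable_cone(1)[OF kF[of z]] u(2) by simp
    have indK: "indicat_real (- K n) \<in> borel_measurable \<mu>" for n
      using sets.compl_sets[OF K(3), of n]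
      by (intro borel_measurable_indicator) (simp add: Compl_eq_Diff_UNIV)
    have step: "- (\<integral>x. u x \<partial>\<mu>) - \<epsilon> + (\<integral>x. indicator (- K n) x * ?g x \<partial>\<mu>) \<le> (\<integral>x. v x \<partial>\<nu>)" for n
    proof -
      obtain I where "finite I \<and> z \<in> I \<and> (\<forall>y\<in>K n. - u y - \<epsilon> \<le> (MAX i\<in>I. k i y))"
        using compact_finite_max[OF u(1) kF kx K(2)[of n] \<epsilon>, of z] by (rule exE)
      then have I: "finite I" "z \<in> I" "\<And>y. y \<in> K n \<Longrightarrow> - u y - \<epsilon> \<le> (MAX i\<in>I. k i y)"
        by blast+
      define w where "w y = (MAX i\<in>I. k i y)" for y
      have w: "w \<in> F"
        unfolding w_def[abs_def] by (intro Max_in_cone kF) (use I in auto)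
      note wi = integrable_cone[OF w]
      have int: "integrable \<mu> (\<lambda>x. indicator (- K n) x * ?g x)"
        by (rule integrable_bounded_mult[where B = 1, OF g indK]) auto
      have "- (\<integral>x. u x \<partial>\<mu>) - \<epsilon> + (\<integral>x. indicator (- K n) x * ?g x \<partial>\<mu>)
          = (\<integral>x. - u x - \<epsilon> + indicator (- K n) x * ?g x \<partial>\<mu>)"
        using u(2) int by simp
      also have "\<dots> \<le> (\<integral>x. w x \<partial>\<mu>)"
      proof (rule integral_mono)
        fix x
        have "k z x \<le> w x" unfolding w_def by (intro Max_ge) (use I in auto)
        then show "- u x - \<epsilon> + indicator (- K n) x * ?g x \<le> w x"
          using I(3)[of x] by (auto simp: w_def split: split_indicator)
      qed (use u(2) int wi in simp_all)
      also have "\<dots> \<le> (\<integral>x. w x \<partial>\<nu>)" by (rule dominated[OF w])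
      also have "\<dots> \<le> (\<integral>x. v x \<partial>\<nu>)"
      proof (rule integral_mono)
        show "w x \<le> v x" for x unfolding w_def by (subst Max_le_iff) (use I kv in auto)
      qed (use v wi in simp_all)
      finally show ?thesis .
    qed
    have "(\<lambda>n. \<integral>x. indicator (- K n) x * ?g x \<partial>\<mu>) \<longlonglongrightarrow> (\<integral>x. 0 \<partial>\<mu>)"
    proof (rule integral_dominated_convergence[where w = "\<lambda>x. norm (?g x)"])
      have "(\<lambda>n. indicator (- K n) x * ?g x) \<longlonglongrightarrow> 0" if x: "x \<notin> UNIV - (\<Union>n. K n)" for x
      proof (rule tendsto_eventually)
        obtain m where "x \<in> K m" using x by blast
        then have "x \<in> K n" if "m \<le> n" for n
          using monoD[OF K(1) that] by blast
        then show "\<forall>\<^sub>F n in sequentially. indicator (- K n) x * ?g x = 0"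
          by (intro eventually_sequentiallyI[of m]) simp
      qed
      then show "AE x in \<mu>. (\<lambda>n. indicator (- K n) x * ?g x) \<longlonglongrightarrow> 0"
        by (rule AE_mp[OF AE_not_in[OF K(4)] AE_I2, OF impI])
      show "(\<lambda>x. indicator (- K n) x * ?g x) \<in> borel_measurable \<mu>" for n
        by (intro borel_measurable_times indK borel_measurable_integrable g)
    qed (use g in \<open>auto split: split_indicator\<close>)
    then have "(\<lambda>n. - (\<integral>x. u x \<partial>\<mu>) - \<epsilon> + (\<integral>x. indicator (- K n) x * ?g x \<partial>\<mu>))
        \<longlonglongrightarrow> - (\<integral>x. u x \<partial>\<mu>) - \<epsilon> + (\<integral>x. 0 \<partial>\<mu>)"
      by (intro tendsto_add tendsto_const)
    then show ?thesis
      using step by (intro LIMSEQ_le_const2[where x = "- (\<integral>x. u x \<partial>\<mu>) - \<epsilon>"]) auto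
  qed
  have "- (\<integral>x. u x \<partial>\<mu>) \<le> (\<integral>x. v x \<partial>\<nu>)"
  proof (rule field_le_epsilon)
    fix \<epsilon> :: real assume "0 < \<epsilon>"
    from bound[OF this] show "- (\<integral>x. u x \<partial>\<mu>) \<le> (\<integral>x. v x \<partial>\<nu>) + \<epsilon>" by simp
  qed
  then show ?thesis by simp
qed

lemma majorised_add:
  assumes "majorised \<phi> u v" and "majorised \<phi>' u' v'"
  shows "majorised (\<lambda>z. \<phi> z + \<phi>' z) (\<lambda>x. u x + u' x) (\<lambda>y. v y + v' y)"
proof -
  obtain \<Phi> \<Phi>' where \<Phi>: "\<And>x. \<Phi> x \<in> F" "\<And>x. \<Phi>' x \<in> F"
      "\<And>x y. \<phi> (x, y) \<le> u x + v y + \<Phi> x x - \<Phi> x y"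
      "\<And>x y. \<phi>' (x, y) \<le> u' x + v' y + \<Phi>' x x - \<Phi>' x y"
    using assms unfolding majorised_def by blast
  show ?thesis
  proof (rule majorisedI[where \<Phi> = "\<lambda>x y. 1 * \<Phi> x y + 1 * \<Phi>' x y"])
    show "openin T {x \<in> topspace T. a < u x + u' x}" for a
      by (rule openin_greater_add) (use assms in \<open>auto simp: majorised_def\<close>)
    show "\<phi> (x, y) + \<phi>' (x, y) \<le> u x + u' x + (v y + v' y) + (1 * \<Phi> x x + 1 * \<Phi>' x x)
        - (1 * \<Phi> x y + 1 * \<Phi>' x y)" for x y
      using \<Phi>(3,4)[of x y] by simp
    show "(\<lambda>y. 1 * \<Phi> x y + 1 * \<Phi>' x y) \<in> F" for x
      by (rule cone) (use \<Phi> in auto)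
  qed (use assms in \<open>auto simp: majorised_def\<close>)
qed

lemma majorised_scale:
  assumes "majorised \<phi> u v" and c: "0 < c"
  shows "majorised (\<lambda>z. c * \<phi> z) (\<lambda>x. c * u x) (\<lambda>y. c * v y)"
proof -
  obtain \<Phi> where \<Phi>: "\<And>x. \<Phi> x \<in> F" "\<And>x y. \<phi> (x, y) \<le> u x + v y + \<Phi> x x - \<Phi> x y"
    using assms unfolding majorised_def by metis
  show ?thesis
  proof (rule majorisedI[where \<Phi> = "\<lambda>x y. c * \<Phi> x y + 0 * \<Phi> x y"])
    show "openin T {x \<in> topspace T. a < c * u x}" for a
      by (rule openin_greater_scale[OF _ c]) (use assms in \<open>auto simp: majorised_def\<close>)
    show "(\<lambda>y. c * \<Phi> x y + 0 * \<Phi> x y) \<in> F" for x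
      by (rule cone) (use \<Phi> c in auto)
    have "c * \<phi> (x, y) \<le> c * (u x + v y + \<Phi> x x - \<Phi> x y)" for x y
      using \<Phi>(2) c by (intro mult_left_mono) auto
    then show "c * \<phi> (x, y) \<le> c * u x + c * v y + (c * \<Phi> x x + 0 * \<Phi> x x)
        - (c * \<Phi> x y + 0 * \<Phi> x y)" for x y
      by (simp add: algebra_simps)
  qed (use assms in \<open>auto simp: majorised_def\<close>)
qed

lemma majorised_marginals:
  assumes "\<And>a. openin T {x \<in> topspace T. a < u x}" and "integrable \<mu> u" and "integrable \<nu> v"
    and "\<And>x y. \<phi> (x, y) \<le> u x + v y"
  shows "majorised \<phi> u v"
  by (rule majorisedI[where \<Phi> = "\<lambda>_ _. 0"]) (use assms const_cone in auto)

lemma majorised_const: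
  assumes "\<And>z. \<phi> z \<le> c" shows "majorised \<phi> (\<lambda>_. c) (\<lambda>_. 0)"
proof (rule majorised_marginals)
  show "openin T {x \<in> topspace T. a < c}" for a
    by (cases "a < c") (auto simp del: topspace_T)
qed (use assms in auto)

lemma majorised_mono:
  assumes "\<And>z. \<psi> z \<le> \<phi> z" and "majorised \<phi> u v" shows "majorised \<psi> u v"
  using assms(2) order_trans[OF assms(1)] unfolding majorised_def by blast

lemma majorised_lower_bound:
  assumes "majorised \<phi> u v" and "\<And>z. c \<le> \<phi> z"
  shows "c \<le> (\<integral>x. u x \<partial>\<mu>) + (\<integral>x. v x \<partial>\<nu>)"
proof -
  have "majorised (\<lambda>_. - c) (\<lambda>_. - c) (\<lambda>_. 0)" by (rule majorised_const) simp
  from majorised_add[OF assms(1) this]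
  have "majorised (\<lambda>z. \<phi> z + - c) (\<lambda>x. u x + - c) v" by simp
  then have "majorised (\<lambda>_. 0) (\<lambda>x. u x + - c) v"
    by (rule majorised_mono[rotated]) (use assms(2) in simp)
  from majorised_zero[OF this] show ?thesis
    using assms(1) by (simp add: majorised_def mu.prob_space)
qed

text \<open>Every function on a discrete space is continuous, so \<open>('a \<times> 'a) discrete \<Rightarrow>\<^sub>C real\<close> is the real
  vector space of all bounded functions on pairs.\<close>
definition upper :: "(('a \<times> 'a) discrete \<Rightarrow>\<^sub>C real) \<Rightarrow> real" where
  "upper \<phi> = Inf {(\<integral>x. u x \<partial>\<mu>) + (\<integral>x. v x \<partial>\<nu>) | u v. majorised (\<lambda>z. \<phi> (discrete z)) u v}"

lemma upper_le:
  assumes "majorised (\<lambda>z. apply_bcontfun \<phi> (discrete z)) u v"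
  shows "upper \<phi> \<le> (\<integral>x. u x \<partial>\<mu>) + (\<integral>x. v x \<partial>\<nu>)"
  unfolding upper_def
proof (rule cInf_lower)
  obtain B where "\<And>z. norm (apply_bcontfun \<phi> z) \<le> B"
    using bounded_apply_bcontfun[of \<phi>] by (auto simp: bounded_iff)
  then have "- B \<le> \<phi> (discrete z)" for z by (metis abs_le_D2 minus_le_iff real_norm_def)
  then show "bdd_below {(\<integral>x. u x \<partial>\<mu>) + (\<integral>x. v x \<partial>\<nu>) | u v. majorised (\<lambda>z. \<phi> (discrete z)) u v}"
    by (intro bdd_belowI[of _ "- B"]) (auto intro: majorised_lower_bound)
qed (use assms in auto)

lemma upper_greatest:
  assumes "\<And>u v. majorised (\<lambda>z. apply_bcontfun \<phi> (discrete z)) u v \<Longrightarrow>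
    c \<le> (\<integral>x. u x \<partial>\<mu>) + (\<integral>x. v x \<partial>\<nu>)"
  shows "c \<le> upper \<phi>"
  unfolding upper_def
proof (rule cInf_greatest)
  obtain B where "\<And>z. norm (apply_bcontfun \<phi> z) \<le> B"
    using bounded_apply_bcontfun[of \<phi>] by (auto simp: bounded_iff)
  then have "\<phi> (discrete z) \<le> B" for z by (metis abs_le_D1 real_norm_def)
  then have "majorised (\<lambda>z. \<phi> (discrete z)) (\<lambda>_. B) (\<lambda>_. 0)" by (rule majorised_const)
  then show "{(\<integral>x. u x \<partial>\<mu>) + (\<integral>x. v x \<partial>\<nu>) | u v. majorised (\<lambda>z. \<phi> (discrete z)) u v} \<noteq> {}"
    by auto
qed (use assms in auto)

lemma sublinear_upper: "sublinear upper"
  unfolding sublinear_def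
proof (intro conjI allI impI)
  fix \<phi> \<psi> :: "('a \<times> 'a) discrete \<Rightarrow>\<^sub>C real"
  have "upper (\<phi> + \<psi>) - ((\<integral>x. u' x \<partial>\<mu>) + (\<integral>x. v' x \<partial>\<nu>)) \<le> upper \<phi>"
    if 1: "majorised (\<lambda>z. \<psi> (discrete z)) u' v'" for u' v'
  proof (rule upper_greatest)
    fix u v assume 2: "majorised (\<lambda>z. \<phi> (discrete z)) u v"
    have "upper (\<phi> + \<psi>) \<le> (\<integral>x. u x + u' x \<partial>\<mu>) + (\<integral>x. v x + v' x \<partial>\<nu>)"
      using majorised_add[OF 2 1] by (intro upper_le) (simp add: plus_bcontfun.rep_eq)
    also have "\<dots> = (\<integral>x. u x \<partial>\<mu>) + (\<integral>x. v x \<partial>\<nu>) + ((\<integral>x. u' x \<partial>\<mu>) + (\<integral>x. v' x \<partial>\<nu>))"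
      using 1 2 by (simp add: majorised_def)
    finally show "upper (\<phi> + \<psi>) - ((\<integral>x. u' x \<partial>\<mu>) + (\<integral>x. v' x \<partial>\<nu>))
        \<le> (\<integral>x. u x \<partial>\<mu>) + (\<integral>x. v x \<partial>\<nu>)"
      by simp
  qed
  then have "upper (\<phi> + \<psi>) - upper \<phi> \<le> upper \<psi>"
    by (intro upper_greatest) (simp add: algebra_simps)
  then show "upper (\<phi> + \<psi>) \<le> upper \<phi> + upper \<psi>" by simp
next
  fix c :: real and \<phi> :: "('a \<times> 'a) discrete \<Rightarrow>\<^sub>C real" assume c: "0 < c"
  have le: "upper (d *\<^sub>R \<psi>) \<le> d * upper \<psi>" if d: "0 < d" for d and \<psi> :: "('a \<times> 'a) discrete \<Rightarrow>\<^sub>C real"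
  proof -
    have "upper (d *\<^sub>R \<psi>) / d \<le> upper \<psi>"
    proof (rule upper_greatest)
      fix u v assume 1: "majorised (\<lambda>z. \<psi> (discrete z)) u v"
      have "upper (d *\<^sub>R \<psi>) \<le> (\<integral>x. d * u x \<partial>\<mu>) + (\<integral>x. d * v x \<partial>\<nu>)"
        using majorised_scale[OF 1 d] by (intro upper_le) (simp add: scaleR_bcontfun.rep_eq)
      also have "\<dots> = d * ((\<integral>x. u x \<partial>\<mu>) + (\<integral>x. v x \<partial>\<nu>))"
        by (simp add: distrib_left)
      finally show "upper (d *\<^sub>R \<psi>) / d \<le> (\<integral>x. u x \<partial>\<mu>) + (\<integral>x. v x \<partial>\<nu>)"
        using d by (simp add: field_simps)
    qed
    then show ?thesis using d by (simp add: field_simps)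
  qed
  have "upper ((1 / c) *\<^sub>R (c *\<^sub>R \<phi>)) \<le> (1 / c) * upper (c *\<^sub>R \<phi>)"
    by (rule le) (use c in simp)
  then have "c * upper \<phi> \<le> upper (c *\<^sub>R \<phi>)" using c by (simp add: field_simps)
  with le[OF c, of \<phi>] show "upper (c *\<^sub>R \<phi>) = c * upper \<phi>" by simp
qed

lemma ex_functional_below_majorants:
  "\<exists>I. (\<forall>\<phi> \<psi>. bounded (range \<phi>) \<longrightarrow> bounded (range \<psi>) \<longrightarrow> I (\<lambda>z. \<phi> z + \<psi> z) = I \<phi> + I \<psi>) \<and>
    (\<forall>c \<phi>. bounded (range \<phi>) \<longrightarrow> I (\<lambda>z. c * \<phi> z) = c * I \<phi>) \<and>
    (\<forall>\<phi> u v. bounded (range \<phi>) \<longrightarrow> majorised \<phi> u v \<longrightarrow> I \<phi> \<le> (\<integral>x. u x \<partial>\<mu>) + (\<integral>x. v x \<partial>\<nu>))"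
proof -
  obtain L where L: "linear L" "\<And>\<phi>. L \<phi> \<le> upper \<phi>"
    using linear_below_sublinear[OF sublinear_upper] by blast
  define J :: "('a \<times> 'a \<Rightarrow> real) \<Rightarrow> ('a \<times> 'a) discrete \<Rightarrow>\<^sub>C real"
    where "J \<phi> = Bcontfun (\<lambda>z. \<phi> (of_discrete z))" for \<phi>
  have J: "apply_bcontfun (J \<phi>) z = \<phi> (of_discrete z)" if "bounded (range \<phi>)" for \<phi> z
  proof -
    have "continuous_on UNIV (\<lambda>z. \<phi> (of_discrete z))"
      by (subst continuous_on_open_vimage) (simp_all add: open_discrete)
    moreover have "bounded (range (\<lambda>z. \<phi> (of_discrete z)))"
      by (rule bounded_subset[OF that]) auto
    ultimately show ?thesis by (simp add: J_def Bcontfun_inverse bcontfun_def)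
  qed
  have "J (\<lambda>z. \<phi> z + \<psi> z) = J \<phi> + J \<psi>" if "bounded (range \<phi>)" "bounded (range \<psi>)" for \<phi> \<psi>
    using that by (intro bcontfun_eqI) (simp add: J plus_bcontfun.rep_eq bounded_plus_comp)
  moreover have "J (\<lambda>z. c * \<phi> z) = c *\<^sub>R J \<phi>" if "bounded (range \<phi>)" for c \<phi>
    using that bounded_scaleR_comp[OF that, of c]
    by (intro bcontfun_eqI) (simp add: J scaleR_bcontfun.rep_eq)
  moreover have "L (J \<phi>) \<le> (\<integral>x. u x \<partial>\<mu>) + (\<integral>x. v x \<partial>\<nu>)"
    if "bounded (range \<phi>)" "majorised \<phi> u v" for \<phi> u v
    using that by (intro order_trans[OF L(2) upper_le]) (simp add: J discrete_inverse)
  ultimately show ?thesis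
    using linear_add[OF L(1)] linear_scale[OF L(1)] by (intro exI[of _ "\<lambda>\<phi>. L (J \<phi>)"]) auto
qed

end

section \<open>The coupling\<close>

text \<open>The sum counts the integers from \<open>1\<close> to \<open>s\<close>, so it is the integer part of \<open>s\<close>.\<close>

lemma sum_of_bool_le:
  assumes "0 \<le> s" and "s \<le> real m"
  shows "s - 1 \<le> (\<Sum>k\<in>{1..m}. of_bool (real k \<le> s))" and "(\<Sum>k\<in>{1..m}. of_bool (real k \<le> s)) \<le> s"
proof -
  have "{k \<in> {1..m}. real k \<le> s} = {1..nat \<lfloor>s\<rfloor>}"
    using assms by (auto simp: le_nat_floor le_floor_iff nat_le_iff le_nat_iff)
  then have "(\<Sum>k\<in>{1..m}. of_bool (real k \<le> s)) = real (nat \<lfloor>s\<rfloor>)"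
    by (simp add: sum.If_cases of_bool_def Int_def)
  then show "s - 1 \<le> (\<Sum>k\<in>{1..m}. of_bool (real k \<le> s))" and "(\<Sum>k\<in>{1..m}. of_bool (real k \<le> s)) \<le> s"
    using assms(1) by linarith+
qed

lemma bounded_range_realI:
  fixes \<phi> :: "'b \<Rightarrow> real"
  assumes "\<And>z. \<bar>\<phi> z\<bar> \<le> B" shows "bounded (range \<phi>)"
  using assms by (auto simp: bounded_iff)

lemma bounded_range_scale:
  fixes \<phi> :: "'b \<Rightarrow> real"
  shows "bounded (range \<phi>) \<Longrightarrow> bounded (range (\<lambda>z. c * \<phi> z))"
  using bounded_scaleR_comp[of \<phi> UNIV c] by simp

lemma bounded_range_const [simp]: "bounded (range (\<lambda>_. c :: real))"
  by (rule bounded_range_realI[where B = "\<bar>c\<bar>"]) simp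

lemma bounded_indicator [simp]: "bounded (range (indicator A :: 'b \<Rightarrow> real))"
  by (rule bounded_range_realI[where B = 1]) (simp split: split_indicator)

text \<open>The functional \<open>I\<close> is a finitely additive candidate for integration against the coupling.\<close>
locale coupling_functional = cone_domination +
  fixes I :: "('a \<times> 'a \<Rightarrow> real) \<Rightarrow> real"
  assumes add: "\<And>\<phi> \<psi>. bounded (range \<phi>) \<Longrightarrow> bounded (range \<psi>) \<Longrightarrow>
      I (\<lambda>z. \<phi> z + \<psi> z) = I \<phi> + I \<psi>"
    and scale: "\<And>c \<phi>. bounded (range \<phi>) \<Longrightarrow> I (\<lambda>z. c * \<phi> z) = c * I \<phi>"
    and majorant: "\<And>\<phi> u v. bounded (range \<phi>) \<Longrightarrow> majorised \<phi> u v \<Longrightarrow>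
      I \<phi> \<le> (\<integral>x. u x \<partial>\<mu>) + (\<integral>x. v x \<partial>\<nu>)"
begin

lemma openin_Compl: "closedin T C \<Longrightarrow> openin T (- C)"
  by (simp add: closedin_def Compl_eq_Diff_UNIV)

lemma measurable_marginals [simp]:
  "measurable \<mu> N = measurable (borel_of T) N" "measurable \<nu> N = measurable (borel_of T) N"
  by (simp_all cong: measurable_cong_sets)

lemma minus: "bounded (range \<phi>) \<Longrightarrow> I (\<lambda>z. - \<phi> z) = - I \<phi>"
  using scale[of \<phi> "- 1"] by simp

lemma upper_bound:
  assumes "bounded (range \<phi>)" "\<And>z. \<phi> z \<le> c" shows "I \<phi> \<le> c"
  using majorant[OF assms(1) majorised_const[OF assms(2)]] by simp

lemma functional_mono:
  assumes \<phi>: "bounded (range \<phi>)" and \<psi>: "bounded (range \<psi>)" and le: "\<And>z. \<phi> z \<le> \<psi> z"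
  shows "I \<phi> \<le> I \<psi>"
proof -
  have m: "bounded (range (\<lambda>z. - \<psi> z))" using bounded_range_scale[OF \<psi>, of "- 1"] by simp
  have "I (\<lambda>z. \<phi> z + - \<psi> z) \<le> 0"
    using le by (intro upper_bound bounded_plus_comp \<phi> m) simp
  then show ?thesis using add[OF \<phi> m] minus[OF \<psi>] by simp
qed

lemma functional_const [simp]: "I (\<lambda>_. c) = c"
proof (rule antisym)
  show "I (\<lambda>_. c) \<le> c" by (rule upper_bound) simp_all
  have "I (\<lambda>_. - c) \<le> - c" by (rule upper_bound) simp_all
  then show "c \<le> I (\<lambda>_. c)" using minus[of "\<lambda>_. c"] by simp
qed

lemma functional_sum:
  assumes "finite J" "\<And>k. k \<in> J \<Longrightarrow> bounded (range (\<phi> k))"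
  shows "bounded (range (\<lambda>z. \<Sum>k\<in>J. \<phi> k z)) \<and> I (\<lambda>z. \<Sum>k\<in>J. \<phi> k z) = (\<Sum>k\<in>J. I (\<phi> k))"
  using assms
proof (induction rule: finite_induct)
  case empty
  show ?case by simp
next
  case (insert k J)
  then have "bounded (range (\<phi> k))" and "bounded (range (\<lambda>z. \<Sum>k\<in>J. \<phi> k z))"
    and "I (\<lambda>z. \<Sum>k\<in>J. \<phi> k z) = (\<Sum>k\<in>J. I (\<phi> k))"
    by auto
  then show ?case using insert(1,2) add by (auto intro: bounded_plus_comp)
qed

definition charge :: "('a \<times> 'a) set \<Rightarrow> real" where
  "charge A = I (indicator A)"

lemma charge_nonneg: "0 \<le> charge A"
proof -
  have "I (\<lambda>_. 0) \<le> I (indicator A)"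
    by (rule functional_mono) (auto intro: bounded_indicator bounded_range_realI)
  then show ?thesis by (simp add: charge_def)
qed

lemma charge_additive:
  assumes "A \<inter> B = {}" shows "charge (A \<union> B) = charge A + charge B"
proof -
  have "(indicator (A \<union> B) :: _ \<Rightarrow> real) = (\<lambda>z. indicator A z + indicator B z)"
    using assms by (auto simp: fun_eq_iff split: split_indicator)
  then show ?thesis by (simp add: charge_def add bounded_indicator)
qed

text \<open>Bounding open sets by the marginals is enough: the regularised measure inherits these bounds, and
  they determine its marginals.\<close>
lemma charge_fst_openin:
  assumes U: "openin T U" shows "charge (U \<times> UNIV) \<le> measure \<mu> U"
proof -
  have Us: "U \<in> sets \<mu>" using U by (simp add: openin_borel_of)
  have "majorised (indicator (U \<times> UNIV)) (indicator U) (\<lambda>_. 0)"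
  proof (rule majorised_marginals)
    fix a :: real
    have "{x \<in> topspace T. a < indicator U x} = (if a < 0 then topspace T else if a < 1 then U else {})"
      by (auto simp: indicator_def)
    then show "openin T {x \<in> topspace T. a < indicator U x}"
      using U by (simp del: topspace_T)
  qed (use Us in \<open>auto simp: indicator_def mu.emeasure_eq_measure\<close>)
  from majorant[OF bounded_indicator this] show ?thesis using Us by (simp add: charge_def)
qed

lemma charge_snd:
  assumes B: "B \<in> sets \<nu>" shows "charge (UNIV \<times> B) \<le> measure \<nu> B"
proof -
  have "majorised (indicator (UNIV \<times> B)) (\<lambda>_. 0) (indicator B)"
  proof (rule majorised_marginals)
    fix a :: real
    show "openin T {x \<in> topspace T. a < 0}" by (cases "a < 0") (auto simp del: topspace_T)
  qed (use B in \<open>auto simp: indicator_def nu.emeasure_eq_measure\<close>)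
  from majorant[OF bounded_indicator this] show ?thesis using B by (simp add: charge_def)
qed

lemma charge_mono: "A \<subseteq> B \<Longrightarrow> charge A \<le> charge B"
  using charge_additive[of A "B - A"] charge_nonneg[of "B - A"] by (simp add: Un_absorb1)

abbreviation TT :: "('a \<times> 'a) topology" where "TT \<equiv> prod_topology T T"

lemma charge_tight:
  assumes "0 < \<epsilon>" shows "\<exists>K. compactin TT K \<and> charge (topspace TT - K) < \<epsilon>"
proof -
  have top: "UNIV \<in> sets \<mu>" "UNIV \<in> sets \<nu>" using sets.top[of \<mu>] sets.top[of \<nu>] by auto
  obtain K where K: "compactin T K" "K \<in> sets \<mu>" "emeasure \<mu> (UNIV - K) < ennreal (\<epsilon> / 2)"
    using radon(1) top(1) assms unfolding radon_measure_def by (meson half_gt_zero)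
  obtain C where C: "compactin T C" "C \<in> sets \<nu>" "emeasure \<nu> (UNIV - C) < ennreal (\<epsilon> / 2)"
    using radon(2) top(2) assms unfolding radon_measure_def by (meson half_gt_zero)
  have KC: "measure \<mu> (- K) < \<epsilon> / 2" "measure \<nu> (- C) < \<epsilon> / 2"
    using K(3) C(3) assms
    by (simp_all add: Compl_eq_Diff_UNIV mu.emeasure_eq_measure nu.emeasure_eq_measure ennreal_less_iff)
  have "openin T (- K)"
    by (rule openin_Compl[OF compactin_imp_closedin[OF Hausdorff K(1)]])
  then have 1: "charge ((- K) \<times> UNIV) < \<epsilon> / 2"
    using charge_fst_openin[of "- K"] KC(1) by simp
  have "- C \<in> sets \<nu>" using sets.compl_sets[OF C(2)] by (simp add: Compl_eq_Diff_UNIV)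
  then have 2: "charge (UNIV \<times> (- C)) < \<epsilon> / 2" using charge_snd[of "- C"] KC(2) by simp
  have "charge (topspace TT - K \<times> C) = charge ((- K) \<times> UNIV) + charge (K \<times> (- C))"
    by (subst charge_additive[symmetric]) (auto intro!: arg_cong[where f = charge])
  also have "charge (K \<times> (- C)) \<le> charge (UNIV \<times> (- C))" by (rule charge_mono) auto
  finally have "charge (topspace TT - K \<times> C) < \<epsilon>" using 1 2 by simp
  moreover have "compactin TT (K \<times> C)" using K C by (simp add: compactin_Times)
  ultimately show ?thesis by blast
qed

sublocale charge: tight_charge TT charge
  by unfold_locales
    (use charge_nonneg charge_additive charge_tight Hausdorff in \<open>auto simp: Hausdorff_space_prod_topology\<close>)

definition coupling :: "('a \<times> 'a) measure" where "coupling = charge.regularisation"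

lemma sets_coupling [simp]: "sets coupling = sets (borel_of TT)"
  by (simp add: coupling_def charge.sets_regularisation)

lemma space_coupling [simp]: "space coupling = UNIV"
  by (simp add: coupling_def charge.space_regularisation)

lemma radon_coupling: "radon_measure TT coupling"
  unfolding coupling_def by (rule charge.radon_regularisation)

lemma prob_space_coupling: "prob_space coupling"
proof (rule prob_spaceI)
  have "charge UNIV = 1" using functional_const[of 1] by (simp add: charge_def indicator_def)
  then show "emeasure coupling (space coupling) = 1"
    using charge.emeasure_regularisation_space by (simp add: coupling_def charge.space_regularisation)
qed

sublocale coupling: prob_space coupling by (rule prob_space_coupling)

lemma measurable_coupling [measurable]:
  "fst \<in> measurable coupling (borel_of T)" "snd \<in> measurable coupling (borel_of T)"
  using measurable_borel_of[OF continuous_map_fst, of T T] measurable_borel_of[OF continuous_map_snd, of T T]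
  by (simp_all add: measurable_def)

lemma distr_fst: "distr coupling (borel_of T) fst = \<mu>"
proof (rule radon_measure_eqI[OF Hausdorff radon(1) prob(1)])
  show "prob_space (distr coupling (borel_of T) fst)"
    by (rule coupling.prob_space_distr) simp
  fix U assume U: "openin T U"
  have "emeasure (distr coupling (borel_of T) fst) U = emeasure coupling (U \<times> UNIV)"
    using U by (subst emeasure_distr) (auto intro!: arg_cong[where f = "emeasure coupling"] simp: openin_borel_of)
  also have "\<dots> \<le> ennreal (charge (U \<times> UNIV))"
    unfolding coupling_def using U openin_topspace[of T]
    by (intro charge.emeasure_regularisation_openin_le) (simp add: openin_prod_Times_iff)
  also have "\<dots> \<le> emeasure \<mu> U"
    using charge_fst_openin[OF U] by (simp add: mu.emeasure_eq_measure ennreal_leI)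
  finally show "emeasure (distr coupling (borel_of T) fst) U \<le> emeasure \<mu> U" .
qed simp

lemma distr_snd: "distr coupling (borel_of T) snd = \<nu>"
proof (rule radon_measure_eqI[OF Hausdorff radon(2) prob(2)])
  show "prob_space (distr coupling (borel_of T) snd)"
    by (rule coupling.prob_space_distr) simp
  fix U assume U: "openin T U"
  have "emeasure (distr coupling (borel_of T) snd) U = emeasure coupling (UNIV \<times> U)"
    using U by (subst emeasure_distr) (auto intro!: arg_cong[where f = "emeasure coupling"] simp: openin_borel_of)
  also have "\<dots> \<le> ennreal (charge (UNIV \<times> U))"
    unfolding coupling_def using U openin_topspace[of T]
    by (intro charge.emeasure_regularisation_openin_le) (simp add: openin_prod_Times_iff)
  also have "\<dots> \<le> emeasure \<nu> U"
    using charge_snd[of U] U by (simp add: nu.emeasure_eq_measure ennreal_leI openin_borel_of)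
  finally show "emeasure (distr coupling (borel_of T) snd) U \<le> emeasure \<nu> U" .
qed simp

text \<open>Regularisation only increases the values of closed sets, and by the layer cake formula this
  carries over to upper semicontinuous functions: \<open>\<phi>\<close> differs by at most \<open>1 / N\<close> from the sum over
  \<open>k \<ge> 1\<close> of the indicators of the closed sets \<open>{z. k / N \<le> \<phi> z}\<close>, divided by \<open>N\<close>.\<close>
lemma functional_le_integral:
  assumes \<phi>: "\<And>z. 0 \<le> \<phi> z" "\<And>z. \<phi> z \<le> B"
    and usc: "\<And>t. closedin TT {z. t \<le> \<phi> z}"
  shows "I \<phi> \<le> (\<integral>z. \<phi> z \<partial>coupling)"
proof -
  have b: "bounded (range \<phi>)" using \<phi> by (intro bounded_range_realI[where B = B]) auto
  have "\<phi> \<in> borel_measurable coupling"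
    unfolding borel_measurable_iff_ge using closedin_borel_of[OF usc] by simp
  then have int: "integrable coupling \<phi>"
    using \<phi> by (intro coupling.integrable_const_bound[where B = B]) auto
  have step: "I \<phi> \<le> 1 / Suc n + (\<integral>z. \<phi> z \<partial>coupling)" for n
  proof -
    define N where "N = real (Suc n)"
    have N: "0 < N" by (simp add: N_def)
    define m where "m = nat \<lceil>B * N\<rceil>"
    define A where "A k = {z. real k / N \<le> \<phi> z}" for k
    have A: "closedin TT (A k)" for k unfolding A_def by (rule usc)
    define s where "s z = (\<Sum>k\<in>{1..m}. indicat_real (A k) z)" for z
    have "\<phi> z * N \<le> B * N" for z using \<phi> N by simp
    then have "\<phi> z * N \<le> real m" for z unfolding m_def by (meson order_trans real_nat_ceiling_ge)
    moreover have "s z = (\<Sum>k\<in>{1..m}. of_bool (real k \<le> \<phi> z * N))" for z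
      unfolding s_def using N by (intro sum.cong) (auto simp: A_def indicator_def field_simps)
    ultimately have s: "\<phi> z * N - 1 \<le> s z" "s z \<le> \<phi> z * N" for z
      using sum_of_bool_le[of "\<phi> z * N" m] \<phi> N by auto
    have bs: "bounded (range s)" and Is: "I s = (\<Sum>k\<in>{1..m}. charge (A k))"
      using functional_sum[of "{1..m}" "\<lambda>k. indicator (A k)"] bounded_indicator
      by (auto simp: s_def[abs_def] charge_def)
    have ints: "integrable coupling (indicat_real (A k))" for k
      using closedin_borel_of[OF A] by (simp add: coupling.emeasure_eq_measure)
    have "N * I \<phi> = I (\<lambda>z. N * \<phi> z)" using scale[OF b] by simp
    also have "\<dots> \<le> I (\<lambda>z. 1 + s z)"
      using s(1) b bs
      by (intro functional_mono bounded_plus_comp bounded_range_scale) (auto simp: algebra_simps)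
    also have "\<dots> = 1 + I s"
      using bs by (subst add) auto
    also have "I s \<le> (\<Sum>k\<in>{1..m}. measure coupling (A k))"
      unfolding Is
    proof (rule sum_mono)
      fix k
      have "ennreal (charge (A k)) \<le> emeasure coupling (A k)"
        unfolding coupling_def by (rule charge.emeasure_regularisation_closedin_ge[OF A])
      then show "charge (A k) \<le> measure coupling (A k)"
        by (simp add: coupling.emeasure_eq_measure)
    qed
    also have "(\<Sum>k\<in>{1..m}. measure coupling (A k)) = (\<integral>z. s z \<partial>coupling)"
      unfolding s_def using ints by (subst Bochner_Integration.integral_sum) auto
    also have "\<dots> \<le> (\<integral>z. \<phi> z * N \<partial>coupling)"
      using ints int s by (intro integral_mono) (auto simp: s_def[abs_def])
    finally have "N * I \<phi> \<le> 1 + (\<integral>z. \<phi> z \<partial>coupling) * N" by simp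
    then have "I \<phi> \<le> 1 / N + (\<integral>z. \<phi> z \<partial>coupling)" using N by (simp add: field_simps)
    then show ?thesis by (simp add: N_def)
  qed
  have "(\<lambda>n. 1 / Suc n + (\<integral>z. \<phi> z \<partial>coupling)) \<longlonglongrightarrow> 0 + (\<integral>z. \<phi> z \<partial>coupling)"
    by (intro tendsto_add tendsto_const) (rule lim_1_over_n[THEN LIMSEQ_Suc])
  then show ?thesis using step by (intro LIMSEQ_le_const) auto
qed

lemma integrable_snd:
  assumes "f \<in> F" shows "integrable coupling (\<lambda>z. f (snd z))"
  using integrable_cone(2)[OF assms] distr_snd measurable_coupling(2)
  by (metis borel_measurable_integrable integrable_distr)

lemma borel_measurable_cone: "f \<in> F \<Longrightarrow> f \<in> borel_measurable (borel_of T)"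
  using openin_greater_continuous[OF continuous_cone] by (intro borel_measurable_borel_of)

text \<open>For compact \<open>K\<close> and non-negative \<open>f\<close> the function \<open>indicator K x * min (f y) n\<close> is upper
  semicontinuous and bounded, so its integral is at least the value of the functional.  Its negative
  is majorised: take \<open>\<Phi> x = f\<close> for \<open>x\<close> in \<open>K\<close> and \<open>\<Phi> x = 0\<close> otherwise, put \<open>u = - indicator K * f\<close>, and
  let \<open>v = f - min f n\<close> absorb the truncation.\<close>
lemma compact_inequality:
  assumes f: "f \<in> F" "\<And>x. 0 \<le> f x" and K: "compactin T K"
  shows "(\<integral>x. indicator K x * f x \<partial>\<mu>) \<le> (\<integral>z. indicator K (fst z) * f (snd z) \<partial>coupling)"
proof -
  have clK: "closedin T K" by (rule compactin_imp_closedin[OF Hausdorff K])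
  have Ks: "K \<in> sets (borel_of T)" by (rule closedin_borel_of[OF clK])
  have cf: "continuous_map T euclideanreal f" by (rule continuous_cone[OF f(1)])
  note [measurable] = borel_measurable_cone[OF f(1)] Ks
  have int_K: "integrable \<mu> (\<lambda>x. indicator K x * f x)"
    by (rule integrable_bounded_mult[where B = 1, OF integrable_cone(1)[OF f(1)]]) (use Ks in auto)
  have int_v: "integrable \<nu> (\<lambda>y. f y - min (f y) (real n))" for n
    by (rule Bochner_Integration.integrable_bound[OF integrable_cone(2)[OF f(1)]]) (use f borel_measurable_cone[OF f(1)] in auto)
  have int_KS: "integrable coupling (\<lambda>z. indicator K (fst z) * f (snd z))"
    by (rule integrable_bounded_mult[where B = 1, OF integrable_snd[OF f(1)]]) auto
  have step: "(\<integral>x. indicator K x * f x \<partial>\<mu>) - (\<integral>y. f y - min (f y) (real n) \<partial>\<nu>)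
      \<le> (\<integral>z. indicator K (fst z) * f (snd z) \<partial>coupling)" for n
  proof -
    define \<phi> where "\<phi> z = indicator K (fst z) * min (f (snd z)) (real n)" for z
    have \<phi>: "0 \<le> \<phi> z" "\<phi> z \<le> real n" for z
      using f(2) by (auto simp: \<phi>_def split: split_indicator)
    have b: "bounded (range \<phi>)" using \<phi> by (intro bounded_range_realI[where B = "real n"]) auto
    have "majorised (\<lambda>z. - \<phi> z) (\<lambda>x. - (indicator K x * f x)) (\<lambda>y. f y - min (f y) (real n))"
    proof (rule majorisedI[where \<Phi> = "\<lambda>x y. if x \<in> K then f y else 0"])
      fix a :: real
      have eq: "{x \<in> topspace T. a < - (indicator K x * f x)} =
          (if a < 0 then - K \<union> {x \<in> topspace T. f x < - a} else {})"
        using f(2) by (auto simp: not_less split: split_indicator) (smt (verit) f(2))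
      have "openin T (- K \<union> {x \<in> topspace T. f x < - a})"
        using openin_continuous_map_preimage[OF cf, of "{..<- a}"] openin_Compl[OF clK]
        by (intro openin_Un) auto
      then show "openin T {x \<in> topspace T. a < - (indicator K x * f x)}"
        unfolding eq by (cases "a < 0") simp_all
    next
      show "(\<lambda>y. if x \<in> K then f y else 0) \<in> F" for x using f(1) const_cone by (cases "x \<in> K") simp_all
      show "- \<phi> (x, y) \<le> - (indicator K x * f x) + (f y - min (f y) (real n))
          + (if x \<in> K then f x else 0) - (if x \<in> K then f y else 0)" for x y
        by (simp add: \<phi>_def)
    qed (use int_K int_v in auto)
    from majorant[OF _ this] minus[OF b] b
    have "- I \<phi> \<le> - (\<integral>x. indicator K x * f x \<partial>\<mu>) + (\<integral>y. f y - min (f y) (real n) \<partial>\<nu>)"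
      using bounded_range_scale[OF b, of "- 1"] by simp
    then have "(\<integral>x. indicator K x * f x \<partial>\<mu>) - (\<integral>y. f y - min (f y) (real n) \<partial>\<nu>) \<le> I \<phi>" by simp
    also have "\<dots> \<le> (\<integral>z. \<phi> z \<partial>coupling)"
    proof (rule functional_le_integral[OF \<phi>])
      fix t
      show "closedin TT {z. t \<le> \<phi> z}"
      proof (cases "t \<le> 0")
        case True
        then have "{z. t \<le> \<phi> z} = topspace TT" using \<phi>(1) by (auto intro: order_trans)
        then show ?thesis by (metis closedin_topspace)
      next
        case False
        have "closedin T {y \<in> topspace T. min (f y) (real n) \<in> {t..}}"
          by (intro closedin_continuous_map_preimage[where Y = euclideanreal] continuous_map_real_min cf) auto
        then have "closedin TT (K \<times> {y. t \<le> min (f y) (real n)})"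
          using clK by (simp add: closedin_prod_Times_iff)
        moreover have "{z. t \<le> \<phi> z} = K \<times> {y. t \<le> min (f y) (real n)}"
          using False by (auto simp: \<phi>_def split: split_indicator)
        ultimately show ?thesis by simp
      qed
    qed
    also have "\<dots> \<le> (\<integral>z. indicator K (fst z) * f (snd z) \<partial>coupling)"
    proof (rule integral_mono)
      show "integrable coupling \<phi>"
      proof (rule coupling.integrable_const_bound[where B = "real n"])
        show "\<phi> \<in> borel_measurable coupling" unfolding \<phi>_def[abs_def] by measurable
      qed (use \<phi> in auto)
      show "\<phi> z \<le> indicator K (fst z) * f (snd z)" for z
        by (auto simp: \<phi>_def split: split_indicator)
    qed (rule int_KS)
    finally show ?thesis .
  qed
  have "(\<lambda>n. \<integral>y. f y - min (f y) (real n) \<partial>\<nu>) \<longlonglongrightarrow> (\<integral>y. 0 \<partial>\<nu>)"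
  proof (rule integral_dominated_convergence[where w = f])
    have "(\<lambda>n. f y - min (f y) (real n)) \<longlonglongrightarrow> 0" for y
    proof (rule tendsto_eventually)
      obtain m where "f y \<le> real m" using real_arch_simple by blast
      then show "\<forall>\<^sub>F n in sequentially. f y - min (f y) (real n) = 0"
        by (intro eventually_sequentiallyI[of m]) auto
    qed
    then show "AE y in \<nu>. (\<lambda>n. f y - min (f y) (real n)) \<longlonglongrightarrow> 0" by simp
  qed (use f integrable_cone(2)[OF f(1)] int_v in auto)
  then have "(\<lambda>n. (\<integral>x. indicator K x * f x \<partial>\<mu>) - (\<integral>y. f y - min (f y) (real n) \<partial>\<nu>))
      \<longlonglongrightarrow> (\<integral>x. indicator K x * f x \<partial>\<mu>) - (\<integral>y. 0 \<partial>\<nu>)"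
    by (intro tendsto_diff tendsto_const)
  then show ?thesis using step by (intro LIMSEQ_le_const2[where x = "\<integral>x. indicator K x * f x \<partial>\<mu>"]) auto
qed

text \<open>For fixed \<open>f\<close> both sides are integrals of \<open>h\<close>, with respect to the measures \<open>m1\<close> and \<open>m2\<close> below.
  The previous lemma compares these on compact sets, hence everywhere by inner regularity of \<open>\<mu>\<close>.\<close>
lemma nonneg_inequality:
  assumes f: "f \<in> F" "\<And>x. 0 \<le> f x"
    and h: "h \<in> borel_measurable (borel_of T)" "\<And>x. 0 \<le> h x" "\<And>x. h x \<le> B"
  shows "(\<integral>x. h x * f x \<partial>\<mu>) \<le> (\<integral>z. h (fst z) * f (snd z) \<partial>coupling)"
proof -
  note [measurable] = borel_measurable_cone[OF f(1)] h(1)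
  define m1 where "m1 = density \<mu> (\<lambda>x. ennreal (f x))"
  define m2 where "m2 = distr (density coupling (\<lambda>z. ennreal (f (snd z)))) (borel_of T) fst"
  have meas2: "(\<lambda>z. ennreal (f (snd z))) \<in> borel_measurable coupling" by measurable
  have "emeasure m1 A \<le> emeasure m2 A" if "A \<in> sets \<mu>" for A
    unfolding m1_def
  proof (rule emeasure_density_le_of_compact[OF radon(1) _ _ _ that])
    show "sets m2 = sets \<mu>" by (simp add: m2_def)
    show "(\<lambda>x. ennreal (f x)) \<in> borel_measurable \<mu>"
      using borel_measurable_integrable[OF integrable_cone(1)[OF f(1)]] by simp
    fix K assume K: "compactin T K" "K \<in> sets \<mu>"
    have [measurable]: "K \<in> sets (borel_of T)" using K by simp
    have "emeasure (density \<mu> (\<lambda>x. ennreal (f x))) K = (\<integral>\<^sup>+x. ennreal (indicator K x * f x) \<partial>\<mu>)"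
      using K borel_measurable_integrable[OF integrable_cone(1)[OF f(1)]]
      by (subst emeasure_density) (auto intro!: nn_integral_cong split: split_indicator)
    also have "\<dots> = ennreal (\<integral>x. indicator K x * f x \<partial>\<mu>)"
      using f(2) K(2)
      by (intro nn_integral_eq_integral integrable_bounded_mult[where B = 1] integrable_cone f(1)) auto
    also have "\<dots> \<le> ennreal (\<integral>z. indicator K (fst z) * f (snd z) \<partial>coupling)"
      by (rule ennreal_leI[OF compact_inequality[OF f K(1)]])
    also have "\<dots> = (\<integral>\<^sup>+z. ennreal (indicator K (fst z) * f (snd z)) \<partial>coupling)"
      using f(2)
      by (intro nn_integral_eq_integral[symmetric] integrable_bounded_mult[where B = 1] integrable_snd f(1)) auto
    also have "\<dots> = (\<integral>\<^sup>+z. ennreal (f (snd z)) * indicator (fst -` K) z \<partial>coupling)"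
      by (auto intro!: nn_integral_cong split: split_indicator)
    also have "\<dots> = emeasure (density coupling (\<lambda>z. ennreal (f (snd z)))) (fst -` K)"
      using measurable_sets[OF measurable_coupling(1), of K] K(2)
      by (subst emeasure_density) auto
    also have "\<dots> = emeasure m2 K"
      unfolding m2_def using K(2) by (subst emeasure_distr) auto
    finally show "emeasure (density \<mu> (\<lambda>x. ennreal (f x))) K \<le> emeasure m2 K" .
  qed
  then have "m1 \<le> m2"
    by (subst le_measure) (auto simp: m1_def m2_def)
  then have "(\<integral>\<^sup>+x. ennreal (h x) \<partial>m1) \<le> (\<integral>\<^sup>+x. ennreal (h x) \<partial>m2)"
    by (intro nn_integral_mono_measure) (simp_all add: m1_def m2_def)
  also have "(\<integral>\<^sup>+x. ennreal (h x) \<partial>m1) = (\<integral>\<^sup>+x. ennreal (h x * f x) \<partial>\<mu>)"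
    unfolding m1_def using h f(2) borel_measurable_cone[OF f(1)]
    by (subst nn_integral_density) (auto simp: ennreal_mult mult.commute)
  also have "(\<integral>\<^sup>+x. ennreal (h x) \<partial>m2) = (\<integral>\<^sup>+z. ennreal (h (fst z) * f (snd z)) \<partial>coupling)"
    unfolding m2_def using h f(2)
    by (subst nn_integral_distr) (auto simp: nn_integral_density ennreal_mult mult.commute)
  finally have le: "(\<integral>\<^sup>+x. ennreal (h x * f x) \<partial>\<mu>) \<le> (\<integral>\<^sup>+z. ennreal (h (fst z) * f (snd z)) \<partial>coupling)" .
  have "integrable \<mu> (\<lambda>x. h x * f x)"
    by (rule integrable_bounded_mult[where B = B, OF integrable_cone(1)[OF f(1)]])
      (use h in auto)
  moreover have "integrable coupling (\<lambda>z. h (fst z) * f (snd z))"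
    by (rule integrable_bounded_mult[where B = B, OF integrable_snd[OF f(1)]]) (use h in auto)
  ultimately have "ennreal (\<integral>x. h x * f x \<partial>\<mu>) \<le> ennreal (\<integral>z. h (fst z) * f (snd z) \<partial>coupling)"
    using le f(2) h(2) by (simp add: nn_integral_eq_integral)
  then show ?thesis using f(2) h(2) by (subst (asm) ennreal_le_iff) auto
qed

text \<open>The functions \<open>max f (- n) + n\<close> are non-negative and in the cone.  The constant \<open>n\<close> contributes
  the same amount to both sides because the first marginal is \<open>\<mu>\<close>, and dominated convergence
  removes the truncation.\<close>
lemma coupling_inequality:
  assumes f: "f \<in> F" and h: "h \<in> borel_measurable (borel_of T)" "\<And>x. 0 \<le> h x" "\<And>x. h x \<le> B"
  shows "(\<integral>x. h x * f x \<partial>\<mu>) \<le> (\<integral>z. h (fst z) * f (snd z) \<partial>coupling)"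
proof -
  note [measurable] = borel_measurable_cone[OF f] h(1)
  have hB: "\<bar>h x\<bar> \<le> B" for x using h by simp
  have h\<mu>: "h \<in> borel_measurable \<mu>" using h(1) by (simp add: measurable_def)
  have h\<pi>: "(\<lambda>z. h (fst z)) \<in> borel_measurable coupling" by measurable
  have marg: "(\<integral>x. h x \<partial>\<mu>) = (\<integral>z. h (fst z) \<partial>coupling)"
    using integral_distr[OF measurable_coupling(1) h(1)] by (simp add: distr_fst)
  have int_h: "integrable \<mu> h" using hB h\<mu> by (intro mu.integrable_const_bound[where B = B]) auto
  have int_h': "integrable coupling (\<lambda>z. h (fst z))"
    using hB h\<pi> by (intro coupling.integrable_const_bound[where B = B]) auto
  define g where "g n x = max (f x) (- real n)" for n :: nat and x
  have gF: "g n \<in> F" for n unfolding g_def[abs_def] by (intro max_cone f const_cone)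
  note ig = integrable_bounded_mult[OF integrable_cone(1)[OF gF] h\<mu> hB]
    integrable_bounded_mult[OF integrable_snd[OF gF] h\<pi> hB]
  have step: "(\<integral>x. h x * g n x \<partial>\<mu>) \<le> (\<integral>z. h (fst z) * g n (snd z) \<partial>coupling)" for n
  proof -
    have "(\<lambda>x. 1 * g n x + 1 * real n) \<in> F" by (rule cone[OF gF const_cone]) auto
    then have "(\<integral>x. h x * (g n x + real n) \<partial>\<mu>) \<le> (\<integral>z. h (fst z) * (g n (snd z) + real n) \<partial>coupling)"
      using h by (intro nonneg_inequality[where B = B]) (auto simp: g_def)
    then show ?thesis
      using ig[of n] int_h int_h' marg by (simp add: distrib_left)
  qed
  have lim: "(\<lambda>n. g n x) \<longlonglongrightarrow> f x" for x
  proof (rule tendsto_eventually)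
    obtain m where "- f x \<le> real m" using real_arch_simple by blast
    then show "\<forall>\<^sub>F n in sequentially. g n x = f x"
      by (intro eventually_sequentiallyI[of m]) (auto simp: g_def)
  qed
  have bound: "\<bar>g n x\<bar> \<le> \<bar>f x\<bar>" for n x by (auto simp: g_def)
  have "(\<lambda>n. \<integral>x. h x * g n x \<partial>\<mu>) \<longlonglongrightarrow> (\<integral>x. h x * f x \<partial>\<mu>)"
  proof (rule integral_dominated_convergence[where w = "\<lambda>x. h x * \<bar>f x\<bar>"])
    show "integrable \<mu> (\<lambda>x. h x * \<bar>f x\<bar>)"
      by (rule integrable_bounded_mult[OF integrable_abs[OF integrable_cone(1)[OF f]] h\<mu> hB])
    show "AE x in \<mu>. (\<lambda>n. h x * g n x) \<longlonglongrightarrow> h x * f x"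
      using lim by (intro AE_I2 tendsto_mult tendsto_const)
    show "AE x in \<mu>. norm (h x * g n x) \<le> h x * \<bar>f x\<bar>" for n
      using bound h(2) by (intro AE_I2) (simp add: abs_mult mult_left_mono)
  qed (intro borel_measurable_integrable ig integrable_bounded_mult[OF integrable_cone(1)[OF f] h\<mu> hB])+
  moreover have "(\<lambda>n. \<integral>z. h (fst z) * g n (snd z) \<partial>coupling) \<longlonglongrightarrow> (\<integral>z. h (fst z) * f (snd z) \<partial>coupling)"
  proof (rule integral_dominated_convergence[where w = "\<lambda>z. h (fst z) * \<bar>f (snd z)\<bar>"])
    show "integrable coupling (\<lambda>z. h (fst z) * \<bar>f (snd z)\<bar>)"
      by (rule integrable_bounded_mult[OF integrable_abs[OF integrable_snd[OF f]] h\<pi> hB])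
    show "AE z in coupling. (\<lambda>n. h (fst z) * g n (snd z)) \<longlonglongrightarrow> h (fst z) * f (snd z)"
      using lim by (intro AE_I2 tendsto_mult tendsto_const)
    show "AE z in coupling. norm (h (fst z) * g n (snd z)) \<le> h (fst z) * \<bar>f (snd z)\<bar>" for n
      using bound h(2) by (intro AE_I2) (simp add: abs_mult mult_left_mono)
  qed (intro borel_measurable_integrable ig integrable_bounded_mult[OF integrable_snd[OF f] h\<pi> hB])+
  ultimately show ?thesis
    by (rule LIMSEQ_le) (use step in auto)
qed

end

theorem (in cone_domination) ex_coupling:
  "\<exists>\<pi>. radon_measure (prod_topology T T) \<pi> \<and> has_marginals T \<pi> \<mu> \<nu> \<and>
    (\<forall>f\<in>F. \<forall>h\<in>borel_measurable (borel_of T). (\<forall>x. 0 \<le> h x) \<and> bounded (range h) \<longrightarrow>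
      (\<integral>x. h x * f x \<partial>\<mu>) \<le> (\<integral>z. h (fst z) * f (snd z) \<partial>\<pi>))"
proof -
  obtain I where I:
    "\<forall>\<phi> \<psi>. bounded (range \<phi>) \<longrightarrow> bounded (range \<psi>) \<longrightarrow> I (\<lambda>z. \<phi> z + \<psi> z) = I \<phi> + I \<psi>"
    "\<forall>c \<phi>. bounded (range \<phi>) \<longrightarrow> I (\<lambda>z. c * \<phi> z) = c * I \<phi>"
    "\<forall>\<phi> u v. bounded (range \<phi>) \<longrightarrow> majorised \<phi> u v \<longrightarrow> I \<phi> \<le> (\<integral>x. u x \<partial>\<mu>) + (\<integral>x. v x \<partial>\<nu>)"
    using ex_functional_below_majorants by (elim exE conjE)
  interpret coupling_functional T F \<mu> \<nu> I
    by unfold_locales (use I in auto)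
  have "(\<integral>x. h x * f x \<partial>\<mu>) \<le> (\<integral>z. h (fst z) * f (snd z) \<partial>coupling)"
    if f: "f \<in> F" and h: "h \<in> borel_measurable (borel_of T)" "\<forall>x. 0 \<le> h x" "bounded (range h)" for f h
  proof -
    obtain B where "\<And>x. norm (h x) \<le> B" using h(3) by (auto simp: bounded_iff)
    then have "h x \<le> B" for x by (metis abs_le_D1 real_norm_def)
    with coupling_inequality[OF f h(1)] h(2) show ?thesis by blast
  qed
  then show ?thesis
    using radon_coupling distr_fst distr_snd by (intro exI[of _ coupling]) (auto simp: has_marginals_def)
qed

section \<open>The topology and the cone generated by a cone of functions\<close>

lemma topspace_initial_topology: "G \<noteq> {} \<Longrightarrow> topspace (initial_topology G) = UNIV"
  unfolding initial_topology_def topology_generated_by_topspace by (auto intro: exI[of _ UNIV])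

lemma openin_initial_topology: "g \<in> G \<Longrightarrow> open U \<Longrightarrow> openin (initial_topology G) (g -` U)"
  unfolding initial_topology_def by (rule topology_generated_by_Basis) auto

lemma continuous_map_initial_topology:
  assumes "g \<in> G" shows "continuous_map (initial_topology G) euclideanreal g"
proof -
  have "topspace (initial_topology G) = UNIV" using assms by (intro topspace_initial_topology) auto
  then show ?thesis
    using openin_initial_topology[OF assms] by (auto simp: continuous_map_def vimage_def)
qed

lemma Hausdorff_initial_topology:
  assumes "separates_points G" shows "Hausdorff_space (initial_topology G)"
  unfolding Hausdorff_space_def
proof (intro allI impI)
  fix x y assume "x \<in> topspace (initial_topology G) \<and> y \<in> topspace (initial_topology G) \<and> x \<noteq> y"
  then obtain g where g: "g \<in> G" "g x \<noteq> g y" using assms by (auto simp: separates_points_def)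
  obtain U V where "open U" "open V" "g x \<in> U" "g y \<in> V" "U \<inter> V = {}"
    using hausdorff[OF g(2)] by blast
  then show "\<exists>U V. openin (initial_topology G) U \<and> openin (initial_topology G) V \<and>
      x \<in> U \<and> y \<in> V \<and> disjnt U V"
    using openin_initial_topology[OF g(1)]
    by (intro exI[of _ "g -` U"] exI[of _ "g -` V"]) (auto simp: disjnt_def)
qed

lemma lattice_cone_least:
  assumes "convex_cone_of_functions C" "G \<subseteq> C" "\<And>f g. f \<in> C \<Longrightarrow> g \<in> C \<Longrightarrow> (\<lambda>x. max (f x) (g x)) \<in> C"
  shows "lattice_cone G \<subseteq> C"
  unfolding lattice_cone_def using assms by (intro Inter_lower) auto

lemma lattice_cone_superset: "G \<subseteq> lattice_cone G"
  by (auto simp: lattice_cone_def)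

lemma lattice_cone_combination:
  "f \<in> lattice_cone G \<Longrightarrow> g \<in> lattice_cone G \<Longrightarrow> 0 \<le> a \<Longrightarrow> 0 \<le> b \<Longrightarrow>
    (\<lambda>x. a * f x + b * g x) \<in> lattice_cone G"
  by (auto simp: lattice_cone_def convex_cone_of_functions_def)

lemma lattice_cone_max:
  "f \<in> lattice_cone G \<Longrightarrow> g \<in> lattice_cone G \<Longrightarrow> (\<lambda>x. max (f x) (g x)) \<in> lattice_cone G"
  by (auto simp: lattice_cone_def)

lemma lattice_cone_continuous:
  assumes "G \<noteq> {}" and f: "f \<in> lattice_cone G"
  shows "continuous_map (initial_topology G) euclideanreal f"
proof -
  have "lattice_cone G \<subseteq> {f. continuous_map (initial_topology G) euclideanreal f}"
    using assms(1) continuous_map_initial_topology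
    by (intro lattice_cone_least) (auto simp: convex_cone_of_functions_def
        intro!: continuous_map_add continuous_map_real_mult continuous_map_real_max)
  then show ?thesis using f by auto
qed

lemma lattice_cone_growth:
  assumes p: "\<And>x. 0 \<le> p x" and "G \<noteq> {}"
    and G: "\<And>g. g \<in> G \<Longrightarrow> \<exists>C>0. \<forall>x. \<bar>g x\<bar> \<le> C * (p x + 1)"
    and f: "f \<in> lattice_cone G"
  shows "\<exists>C>0. \<forall>x. \<bar>f x\<bar> \<le> C * (p x + (1 :: real))"
proof -
  let ?C = "{f. \<exists>C>0. \<forall>x. \<bar>f x\<bar> \<le> C * (p x + 1)}"
  have "lattice_cone G \<subseteq> ?C"
  proof (rule lattice_cone_least)
    show "convex_cone_of_functions ?C"
      unfolding convex_cone_of_functions_def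
    proof (intro conjI ballI allI impI)
      show "?C \<noteq> {}" using G assms(2) by blast
      fix f g and a b :: real assume "f \<in> ?C" "g \<in> ?C" and ab: "0 \<le> a" "0 \<le> b"
      then obtain C D where C: "0 < C" "\<And>x. \<bar>f x\<bar> \<le> C * (p x + 1)"
        and D: "0 < D" "\<And>x. \<bar>g x\<bar> \<le> D * (p x + 1)" by blast
      have "\<bar>a * f x + b * g x\<bar> \<le> (a * C + b * D + 1) * (p x + 1)" for x
      proof -
        have "\<bar>a * f x + b * g x\<bar> \<le> a * \<bar>f x\<bar> + b * \<bar>g x\<bar>"
          using ab by (metis abs_mult abs_of_nonneg abs_triangle_ineq)
        also have "\<dots> \<le> a * (C * (p x + 1)) + b * (D * (p x + 1))"
          using ab C D by (intro add_mono mult_left_mono)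
        also have "\<dots> \<le> (a * C + b * D + 1) * (p x + 1)"
          using p[of x] by (simp add: algebra_simps)
        finally show ?thesis .
      qed
      moreover have "0 < a * C + b * D + 1" using ab C(1) D(1) by (simp add: add_nonneg_pos)
      ultimately show "(\<lambda>x. a * f x + b * g x) \<in> ?C" by blast
    qed
    show "G \<subseteq> ?C" using G by blast
    fix f g assume "f \<in> ?C" "g \<in> ?C"
    then obtain C D where C: "0 < C" "\<And>x. \<bar>f x\<bar> \<le> C * (p x + 1)"
      and D: "0 < D" "\<And>x. \<bar>g x\<bar> \<le> D * (p x + 1)" by blast
    have "\<bar>max (f x) (g x)\<bar> \<le> (C + D) * (p x + 1)" for x
    proof -
      have "0 \<le> C * (p x + 1)" "0 \<le> D * (p x + 1)" using C(1) D(1) p[of x] by auto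
      then show ?thesis using C(2)[of x] D(2)[of x] by (simp add: distrib_right max_def)
    qed
    then show "(\<lambda>x. max (f x) (g x)) \<in> ?C" using C(1) D(1) by (auto intro!: exI[of _ "C + D"])
  qed
  then show ?thesis using f by blast
qed

text \<open>A non-negative proper function on a Hausdorff space is lower semicontinuous, since its sublevel
  sets are compact and therefore closed.\<close>
lemma proper_function_measurable:
  assumes T: "Hausdorff_space T" and p: "proper_function T p" "\<And>x. 0 \<le> p x"
  shows "p \<in> borel_measurable (borel_of T)"
  unfolding borel_measurable_iff_le
proof
  fix a
  have "{x \<in> topspace T. p x \<le> a} = p -` {0..a} \<inter> topspace T" using p(2) by auto
  moreover have "compactin T (p -` {0..a} \<inter> topspace T)"
    using p(1) by (auto simp: proper_function_def)
  ultimately show "{x \<in> space (borel_of T). p x \<le> a} \<in> sets (borel_of T)"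
    by (auto intro: closedin_borel_of compactin_imp_closedin[OF T])
qed

lemma integrable_of_growth:
  fixes f p :: "'a \<Rightarrow> real"
  assumes "prob_space M" and p: "p \<in> borel_measurable M" "\<And>x. 0 \<le> p x" "(\<integral>\<^sup>+ x. ennreal (p x) \<partial>M) < \<infinity>"
    and f: "f \<in> borel_measurable M" "\<And>x. \<bar>f x\<bar> \<le> C * (p x + 1)"
  shows "integrable M f"
proof -
  interpret prob_space M by fact
  have "integrable M p" using p by (intro integrableI_nonneg) auto
  then have "integrable M (\<lambda>x. C * (p x + 1))" by simp
  then show ?thesis
  proof (rule Bochner_Integration.integrable_bound)
    show "AE x in M. norm (f x) \<le> norm (C * (p x + 1))"
      using f(2) by (intro AE_I2) (metis abs_ge_self order_trans real_norm_def)
  qed (rule f)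
qed

theorem theorem1p4:
  fixes G :: "('a \<Rightarrow> real) set" and p :: "'a \<Rightarrow> real" and \<mu> \<nu> :: "'a measure"
  assumes "convex_cone_of_functions G"
    and "\<And>c. (\<lambda>_. c) \<in> G"
    and "separates_points G"
    and "\<And>x. 0 \<le> p x"
    and "(\<lambda>x. ereal (p x)) \<in> complete_lattice_cone G"
    and "proper_function (initial_topology G) p"
    and "\<And>g. g \<in> G \<Longrightarrow> \<exists>C>0. \<forall>x. \<bar>g x\<bar> \<le> C * (p x + 1)"
    and "prob_space \<mu>" and "radon_measure (initial_topology G) \<mu>"
    and "prob_space \<nu>" and "radon_measure (initial_topology G) \<nu>"
    and "(\<integral>\<^sup>+ x. ennreal (p x) \<partial>\<mu>) < \<infinity>"
    and "(\<integral>\<^sup>+ x. ennreal (p x) \<partial>\<nu>) < \<infinity>"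
  shows "((\<forall>f\<in>lattice_cone G. (\<integral>x. f x \<partial>\<mu>) \<le> (\<integral>x. f x \<partial>\<nu>)) \<longrightarrow>
          (\<exists>\<pi>. radon_measure (prod_topology (initial_topology G) (initial_topology G)) \<pi> \<and>
               has_marginals (initial_topology G) \<pi> \<mu> \<nu> \<and>
               (\<forall>f\<in>lattice_cone G. \<forall>h\<in>borel_measurable (borel_of (initial_topology G)).
                  (\<forall>x. 0 \<le> h x) \<and> bounded (range h) \<longrightarrow>
                  (\<integral>x. h x * f x \<partial>\<mu>) \<le> (\<integral>z. h (fst z) * f (snd z) \<partial>\<pi>))))
       \<and> (\<forall>\<pi>. radon_measure (prod_topology (initial_topology G) (initial_topology G)) \<pi> \<and>
               has_marginals (initial_topology G) \<pi> \<mu> \<nu> \<and>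
               (\<forall>f\<in>lattice_cone G. \<forall>h\<in>borel_measurable (borel_of (initial_topology G)).
                  (\<forall>x. 0 \<le> h x) \<and> bounded (range h) \<longrightarrow>
                  (\<integral>x. h x * f x \<partial>\<mu>) \<le> (\<integral>z. h (fst z) * f (snd z) \<partial>\<pi>)) \<longrightarrow>
          (\<forall>f\<in>lattice_cone G. (\<integral>x. f x \<partial>\<mu>) \<le> (\<integral>x. f x \<partial>\<nu>)))"
proof -
  let ?T = "initial_topology G"
  have ne: "G \<noteq> {}" using assms(2) by blast
  have T: "Hausdorff_space ?T" by (rule Hausdorff_initial_topology) fact
  have sets: "sets \<mu> = sets (borel_of ?T)" "sets \<nu> = sets (borel_of ?T)"
    using assms(9,11) by (simp_all add: radon_measure_def)
  have p: "p \<in> borel_measurable (borel_of ?T)"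
    by (rule proper_function_measurable[OF T]) fact+
  have f: "f \<in> borel_measurable (borel_of ?T)" if "f \<in> lattice_cone G" for f
    using openin_greater_continuous[OF lattice_cone_continuous[OF ne that]]
    by (rule borel_measurable_borel_of)
  have int: "integrable M f"
    if M: "prob_space M" "sets M = sets (borel_of ?T)" "(\<integral>\<^sup>+ x. ennreal (p x) \<partial>M) < \<infinity>"
      and fF: "f \<in> lattice_cone G" for M f
  proof -
    have meas: "borel_measurable M = (borel_measurable (borel_of ?T) :: ('a \<Rightarrow> real) set)"
      by (rule measurable_cong_sets[OF M(2) refl])
    obtain C where "\<And>x. \<bar>f x\<bar> \<le> C * (p x + 1)"
      using lattice_cone_growth[OF assms(4) ne assms(7) fF] by blast
    with M f[OF fF] p assms(4) show ?thesis by (intro integrable_of_growth[of M p f C]) (auto simp: meas)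
  qed
  show ?thesis
  proof (intro conjI impI allI ballI)
    assume dom: "\<forall>f\<in>lattice_cone G. (\<integral>x. f x \<partial>\<mu>) \<le> (\<integral>x. f x \<partial>\<nu>)"
    interpret cone_domination ?T "lattice_cone G" \<mu> \<nu>
    proof (rule cone_domination.intro)
      show "topspace ?T = UNIV" by (rule topspace_initial_topology[OF ne])
      show "(\<lambda>_. c) \<in> lattice_cone G" for c using assms(2) lattice_cone_superset by blast
      show "integrable \<mu> f" "integrable \<nu> f" if "f \<in> lattice_cone G" for f
        using int[OF assms(8) sets(1) assms(12) that] int[OF assms(10) sets(2) assms(13) that] by simp_all
      show "(\<integral>x. f x \<partial>\<mu>) \<le> (\<integral>x. f x \<partial>\<nu>)" if "f \<in> lattice_cone G" for f
        using dom that by blast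
    qed (fact T assms | rule lattice_cone_combination lattice_cone_max lattice_cone_continuous[OF ne]; assumption)+
    show "\<exists>\<pi>. radon_measure (prod_topology ?T ?T) \<pi> \<and> has_marginals ?T \<pi> \<mu> \<nu> \<and>
        (\<forall>f\<in>lattice_cone G. \<forall>h\<in>borel_measurable (borel_of ?T). (\<forall>x. 0 \<le> h x) \<and> bounded (range h) \<longrightarrow>
          (\<integral>x. h x * f x \<partial>\<mu>) \<le> (\<integral>z. h (fst z) * f (snd z) \<partial>\<pi>))"
      by (rule ex_coupling)
  next
    fix \<pi> g
    assume \<pi>: "radon_measure (prod_topology ?T ?T) \<pi> \<and> has_marginals ?T \<pi> \<mu> \<nu> \<and>
        (\<forall>f\<in>lattice_cone G. \<forall>h\<in>borel_measurable (borel_of ?T). (\<forall>x. 0 \<le> h x) \<and> bounded (range h) \<longrightarrow>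
          (\<integral>x. h x * f x \<partial>\<mu>) \<le> (\<integral>z. h (fst z) * f (snd z) \<partial>\<pi>))"
      and g: "g \<in> lattice_cone G"
    have "snd \<in> measurable \<pi> (borel_of ?T)"
      using \<pi> measurable_borel_of[OF continuous_map_snd, of ?T ?T]
      by (simp add: radon_measure_def cong: measurable_cong_sets)
    then have "(\<integral>x. g x \<partial>\<nu>) = (\<integral>z. g (snd z) \<partial>\<pi>)"
      using integral_distr[of snd \<pi> "borel_of ?T" g] f[OF g] \<pi> by (simp add: has_marginals_def)
    moreover have "(\<integral>x. 1 * g x \<partial>\<mu>) \<le> (\<integral>z. 1 * g (snd z) \<partial>\<pi>)"
      using conjunct2[OF conjunct2[OF \<pi>], rule_format, OF g, of "\<lambda>_. 1"] by simp
    ultimately show "(\<integral>x. g x \<partial>\<mu>) \<le> (\<integral>x. g x \<partial>\<nu>)" by simp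
  qed
qed

end
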